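(* Let $e\ge3$ and $r\ge3$, and let $B$ be the braid group of $G(e,e,r)$ with its Broué–Malle–Rouquier generating set $\mathcal T=\{\tau_2,\tau_2',\tau_3,\dots,\tau_r\}$. There is no finite presentation of $B$ with generating set $\mathcal T$, all of whose relations are equalities between positive words over $\mathcal T$, for which the corresponding monoid embeds in $B$. In other words, there is no finite set $\mathcal P$ of relations $u=v$ with $u,v\in\mathcal T^*$ such that the group $\langle\mathcal T\mid\mathcal P\rangle$ is $B$ (via the identity on $\mathcal T$) and the natural map from the monoid defined by $\langle\mathcal T\mid\mathcal P\rangle$ to $B$ is injective.
   Context: The braid group $B$ of the complex reflection group $G(e,e,r)$ is the group generated by $\mathcal T=\{\tau_2,\tau_2',\tau_3,\dots,\tau_r\}$ with defining relations (the Broué–Malle–Rouquier presentation): $\tau_i\tau_j=\tau_j\tau_i$ for $|i-j|\ge2$; $\tau_2'\tau_j=\tau_j\tau_2'$ for $j\ge4$; $\langle\tau_2\tau_2'\rangle^e=\langle\tau_2'\tau_2\rangle^e$; $\tau_i\tau_{i+1}\tau_i=\tau_{i+1}\tau_i\tau_{i+1}$ for $2\le i\le r-1$; $\tau_2'\tau_3\tau_2'=\tau_3\tau_2'\tau_3$; $\tau_3\tau_2\tau_2'\tau_3\tau_2\tau_2'=\tau_2\tau_2'\tau_3\tau_2\tau_2'\tau_3$. Here $\langle ab\rangle^k$ denotes the alternating product $aba\cdots$ with $k$ factors. *)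

theory Defs
  imports "HOL-Algebra.Group"
begin

inductive_set pcong :: "'a set \<Rightarrow> ('a list \<times> 'a list) set \<Rightarrow> ('a list \<times> 'a list) set"
  for X :: "'a set" and R :: "('a list \<times> 'a list) set" where
  base: "(u, v) \<in> R \<Longrightarrow> u \<in> lists X \<Longrightarrow> v \<in> lists X \<Longrightarrow> (u, v) \<in> pcong X R"
| refl: "w \<in> lists X \<Longrightarrow> (w, w) \<in> pcong X R"
| sym: "(u, v) \<in> pcong X R \<Longrightarrow> (v, u) \<in> pcong X R"
| trans: "(u, v) \<in> pcong X R \<Longrightarrow> (v, w) \<in> pcong X R \<Longrightarrow> (u, w) \<in> pcong X R"
| append: "(u, v) \<in> pcong X R \<Longrightarrow> (u', v') \<in> pcong X R \<Longrightarrow> (u @ u', v @ v') \<in> pcong X R"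

definition word_class :: "'a set \<Rightarrow> ('a list \<times> 'a list) set \<Rightarrow> 'a list \<Rightarrow> 'a list set" where
  "word_class X R w = pcong X R `` {w}"

definition pres_monoid :: "'a set \<Rightarrow> ('a list \<times> 'a list) set \<Rightarrow> 'a list set monoid" where
  "pres_monoid X R =
     \<lparr>carrier = lists X // pcong X R,
      mult = (\<lambda>A B. \<Union>a\<in>A. \<Union>b\<in>B. word_class X R (a @ b)),
      one = word_class X R []\<rparr>"

text \<open>A group given by positive relations is presented as a monoid over signed letters:
  \<open>(x, True)\<close> stands for the generator \<open>x\<close> and \<open>(x, False)\<close> for its formal inverse.\<close>

definition pos_word :: "'a list \<Rightarrow> ('a \<times> bool) list" where
  "pos_word w = map (\<lambda>x. (x, True)) w"

definition group_rels ::
  "'a set \<Rightarrow> ('a list \<times> 'a list) set \<Rightarrow> (('a \<times> bool) list \<times> ('a \<times> bool) list) set" where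
  "group_rels X R =
     {(pos_word u, pos_word v) | u v. (u, v) \<in> R} \<union>
     {([(x, b), (x, \<not> b)], []) | x b. x \<in> X}"

definition pres_group :: "'a set \<Rightarrow> ('a list \<times> 'a list) set \<Rightarrow> ('a \<times> bool) list set monoid" where
  "pres_group X R = pres_monoid (X \<times> UNIV) (group_rels X R)"

definition monoid_gen :: "'a set \<Rightarrow> ('a list \<times> 'a list) set \<Rightarrow> 'a \<Rightarrow> 'a list set" where
  "monoid_gen X R x = word_class X R [x]"

definition group_gen :: "'a set \<Rightarrow> ('a list \<times> 'a list) set \<Rightarrow> 'a \<Rightarrow> ('a \<times> bool) list set" where
  "group_gen X R x = word_class (X \<times> UNIV) (group_rels X R) [(x, True)]"

lemma pcong_lists: "(u, v) \<in> pcong X R \<Longrightarrow> u \<in> lists X \<and> v \<in> lists X"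
  by (induction rule: pcong.induct) auto

lemma equiv_pcong: "equiv (lists X) (pcong X R)"
proof (rule equivI)
  show "pcong X R \<subseteq> lists X \<times> lists X"
    using pcong_lists by fastforce
  show "refl_on (lists X) (pcong X R)"
    by (auto simp: refl_on_def intro: pcong.refl)
  show "sym (pcong X R)"
    by (auto intro: symI pcong.sym)
  show "trans (pcong X R)"
    by (auto intro: transI pcong.trans)
qed

lemma word_class_eq_iff:
  assumes "u \<in> lists X" "v \<in> lists X"
  shows "word_class X R u = word_class X R v \<longleftrightarrow> (u, v) \<in> pcong X R"
  unfolding word_class_def using assms by (simp add: eq_equiv_class_iff [OF equiv_pcong])

lemma carrier_pres_monoid: "carrier (pres_monoid X R) = word_class X R ` lists X"
  by (auto simp: pres_monoid_def word_class_def quotient_def)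

lemma one_pres_monoid: "\<one>\<^bsub>pres_monoid X R\<^esub> = word_class X R []"
  by (simp add: pres_monoid_def)

lemma mult_pres_monoid:
  assumes "u \<in> lists X" "v \<in> lists X"
  shows "word_class X R u \<otimes>\<^bsub>pres_monoid X R\<^esub> word_class X R v = word_class X R (u @ v)"
proof -
  have eq: "word_class X R (a @ b) = word_class X R (u @ v)"
    if "a \<in> word_class X R u" "b \<in> word_class X R v" for a b
  proof -
    have "(u @ v, a @ b) \<in> pcong X R"
      using that by (auto simp: word_class_def intro: pcong.append)
    then show ?thesis
      using pcong_lists word_class_eq_iff by metis
  qed
  have "u \<in> word_class X R u" "v \<in> word_class X R v"
    using assms by (auto simp: word_class_def intro: pcong.refl)
  then have "(\<Union>a\<in>word_class X R u. \<Union>b\<in>word_class X R v. word_class X R (a @ b))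
      = word_class X R (u @ v)"
    using eq by blast
  then show ?thesis
    by (simp add: pres_monoid_def)
qed

lemma monoid_pres_monoid: "monoid (pres_monoid X R)"
proof -
  have carr: "A \<in> carrier (pres_monoid X R) \<longleftrightarrow> (\<exists>u. set u \<subseteq> X \<and> A = word_class X R u)" for A
    by (auto simp: carrier_pres_monoid lists_eq_set)
  have mult: "word_class X R u \<otimes>\<^bsub>pres_monoid X R\<^esub> word_class X R v = word_class X R (u @ v)"
    if "set u \<subseteq> X" "set v \<subseteq> X" for u v
    using that by (simp add: mult_pres_monoid lists_eq_set)
  show ?thesis
  proof (rule monoidI)
    fix A B
    assume "A \<in> carrier (pres_monoid X R)" "B \<in> carrier (pres_monoid X R)"
    then obtain u v where "set u \<subseteq> X" "set v \<subseteq> X" "A = word_class X R u" "B = word_class X R v"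
      unfolding carr by blast
    then show "A \<otimes>\<^bsub>pres_monoid X R\<^esub> B \<in> carrier (pres_monoid X R)"
      unfolding carr by (intro exI [of _ "u @ v"]) (simp add: mult)
  next
    show "\<one>\<^bsub>pres_monoid X R\<^esub> \<in> carrier (pres_monoid X R)"
      unfolding carr one_pres_monoid by (intro exI [of _ "[]"]) simp
  qed (force simp: carr one_pres_monoid mult)+
qed

lemma group_pres_group: "group (pres_group X R)"
proof -
  let ?Y = "X \<times> (UNIV :: bool set)" and ?S = "group_rels X R"
  interpret monoid "pres_group X R"
    unfolding pres_group_def by (rule monoid_pres_monoid)
  have inv: "\<exists>v \<in> lists ?Y. (v @ w, []) \<in> pcong ?Y ?S" if "w \<in> lists ?Y" for w
    using that
  proof (induction w rule: list.induct)
    case Nil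
    have "([] @ [], []) \<in> pcong ?Y ?S"
      by (auto intro: pcong.refl)
    then show ?case
      by blast
  next
    case (Cons a w)
    obtain x b where a: "a = (x, b)"
      by (cases a)
    with Cons.prems have x: "x \<in> X"
      by auto
    have w: "w \<in> lists ?Y"
      using Cons.prems by simp
    from Cons.IH [OF w] obtain v where v: "v \<in> lists ?Y" "(v @ w, []) \<in> pcong ?Y ?S"
      by blast
    have "([(x, \<not> b), (x, \<not> \<not> b)], []) \<in> ?S"
      unfolding group_rels_def using x by blast
    then have "([(x, \<not> b), a], []) \<in> pcong ?Y ?S"
      using x a by (intro pcong.base) auto
    then have "([(x, \<not> b), a] @ w, [] @ w) \<in> pcong ?Y ?S"
      by (rule pcong.append [OF _ pcong.refl [OF w]])
    then have "(v @ ([(x, \<not> b), a] @ w), v @ ([] @ w)) \<in> pcong ?Y ?S"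
      by (rule pcong.append [OF pcong.refl [OF v(1)]])
    then have "((v @ [(x, \<not> b)]) @ a # w, []) \<in> pcong ?Y ?S"
      using v(2) pcong.trans by fastforce
    moreover have "v @ [(x, \<not> b)] \<in> lists ?Y"
      using v(1) x by simp
    ultimately show ?case
      by blast
  qed
  show ?thesis
  proof (rule group_l_invI)
    fix A assume "A \<in> carrier (pres_group X R)"
    then obtain w where w: "w \<in> lists ?Y" "A = word_class ?Y ?S w"
      by (auto simp: pres_group_def carrier_pres_monoid)
    obtain v where v: "v \<in> lists ?Y" "(v @ w, []) \<in> pcong ?Y ?S"
      using inv w(1) by blast
    have "word_class ?Y ?S (v @ w) = word_class ?Y ?S []"
      using v w(1) by (subst word_class_eq_iff) auto
    then have "word_class ?Y ?S v \<otimes>\<^bsub>pres_group X R\<^esub> A = \<one>\<^bsub>pres_group X R\<^esub>"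
      unfolding w(2) pres_group_def one_pres_monoid mult_pres_monoid [OF v(1) w(1)] .
    moreover have "word_class ?Y ?S v \<in> carrier (pres_group X R)"
      unfolding pres_group_def carrier_pres_monoid using v(1) by (rule imageI)
    ultimately show "\<exists>B\<in>carrier (pres_group X R). B \<otimes>\<^bsub>pres_group X R\<^esub> A = \<one>\<^bsub>pres_group X R\<^esub>"
      by blast
  qed
qed

datatype bmr_gen = Tau nat | Tau2'

definition bmr_gens :: "nat \<Rightarrow> bmr_gen set" where
  "bmr_gens r = insert Tau2' (Tau ` {2..r})"

fun alt_prod :: "'a \<Rightarrow> 'a \<Rightarrow> nat \<Rightarrow> 'a list" where
  "alt_prod a b 0 = []"
| "alt_prod a b (Suc k) = a # alt_prod b a k"

definition bmr_rels :: "nat \<Rightarrow> nat \<Rightarrow> (bmr_gen list \<times> bmr_gen list) set" where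
  "bmr_rels e r =
     {([Tau i, Tau j], [Tau j, Tau i]) | i j.
        i \<in> {2..r} \<and> j \<in> {2..r} \<and> 2 \<le> \<bar>int i - int j\<bar>} \<union>
     {([Tau2', Tau j], [Tau j, Tau2']) | j. 4 \<le> j \<and> j \<le> r} \<union>
     {(alt_prod (Tau 2) Tau2' e, alt_prod Tau2' (Tau 2) e)} \<union>
     {([Tau i, Tau (i + 1), Tau i], [Tau (i + 1), Tau i, Tau (i + 1)]) | i.
        2 \<le> i \<and> i + 1 \<le> r} \<union>
     {([Tau2', Tau 3, Tau2'], [Tau 3, Tau2', Tau 3])} \<union>
     {([Tau 3, Tau 2, Tau2', Tau 3, Tau 2, Tau2'],
       [Tau 2, Tau2', Tau 3, Tau 2, Tau2', Tau 3])}"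

definition bmr_braid_group :: "nat \<Rightarrow> nat \<Rightarrow> (bmr_gen \<times> bool) list set monoid" where
  "bmr_braid_group e r = pres_group (bmr_gens r) (bmr_rels e r)"

definition bmr_elem :: "nat \<Rightarrow> nat \<Rightarrow> bmr_gen \<Rightarrow> (bmr_gen \<times> bool) list set" where
  "bmr_elem e r = group_gen (bmr_gens r) (bmr_rels e r)"

text \<open>The maps \<open>\<phi>\<close> and \<open>\<psi>\<close> below are determined by their values on the generators, so they are the
  natural maps.  A multiplicative map from a monoid to a group preserves the unit, hence
  membership in \<^const>\<open>mon\<close> means being an injective monoid homomorphism.\<close>

definition presents_via_identity ::
  "'a set \<Rightarrow> ('a list \<times> 'a list) set \<Rightarrow> ('a \<Rightarrow> 'g) \<Rightarrow> 'g monoid \<Rightarrow> bool" where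
  "presents_via_identity X P \<iota> G \<longleftrightarrow>
     (\<exists>\<phi> \<in> iso (pres_group X P) G. \<forall>x\<in>X. \<phi> (group_gen X P x) = \<iota> x)"

definition monoid_embeds ::
  "'a set \<Rightarrow> ('a list \<times> 'a list) set \<Rightarrow> ('a \<Rightarrow> 'g) \<Rightarrow> 'g monoid \<Rightarrow> bool" where
  "monoid_embeds X P \<iota> G \<longleftrightarrow>
     (\<exists>\<psi> \<in> mon (pres_monoid X P) G. \<forall>x\<in>X. \<psi> (monoid_gen X P x) = \<iota> x)"

end

theory Submission
  imports Defs
begin

text \<open>
  Write \<open>a\<close>, \<open>b\<close>, \<open>s\<close> for \<open>Tau 2\<close>, \<open>Tau2'\<close>, \<open>Tau 3\<close>. In the braid group,
  \<open>s a b s a\<^sup>k b = a b\<^sup>k s a b s\<close> holds for every \<open>k\<close>. However, \<open>s a b s a\<^sup>k\<close> and \<open>a\<^sup>k b\<close>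
  are each the only positive word over the BMR generators representing their element. A valid
  relation whose sides have length at most \<open>k\<close> therefore cannot change the word
  \<open>s a b s a\<^sup>k b\<close>: each of its factors of length at most \<open>k\<close> lies in one of these two words.
  So no finite set of relations suffices.

  Uniqueness is checked in the monoid of Corran and Picantin, which adds the letters \<open>t\<^sub>i\<close>,
  \<open>i\<close> modulo \<open>e\<close>, with \<open>t\<^sub>1 = a\<close>, \<open>t\<^sub>0 = b\<close> and all products \<open>t\<^sub>i t\<^bsub>i-1\<^esub>\<close> equal. This monoid
  satisfies the cube condition, so it is left cancellative and common multiples of letters are
  multiples of explicit least ones. It has a central element divisible by every letter. Inverting
  that element yields a group receiving the braid group, so positive words that are equal in the
  braid group are already equal in the monoid.
\<close>

section \<open>The Corran--Picantin monoid\<close>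

text \<open>\<open>T i\<close> is the letter \<open>t\<^sub>i\<close> and \<open>S k\<close> the generator \<open>Tau k\<close> for \<open>k \<ge> 3\<close>. The superfluous
  letters \<open>T i\<close> with \<open>i \<ge> e\<close> and \<open>S k\<close> with \<open>k < 3\<close> or \<open>k > r\<close> do no harm.\<close>

datatype cp_gen = T nat | S nat

locale corran_picantin =
  fixes e :: nat
  assumes e_ge: "3 \<le> e"
begin

text \<open>Predecessor modulo \<open>e\<close>. The values for \<open>i \<ge> e\<close> keep the function injective and free of
  fixed points; the cube condition needs both.\<close>

definition prd :: "nat \<Rightarrow> nat" where
  "prd i = (if i = 0 then e - 1 else if i < e then i - 1 else Suc i)"

text \<open>The right complement: \<open>x # compl x y\<close> and \<open>y # compl y x\<close> both represent the least common
  right multiple of \<open>x\<close> and \<open>y\<close>.\<close>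

fun compl :: "cp_gen \<Rightarrow> cp_gen \<Rightarrow> cp_gen list" where
  "compl (T i) (T j) = (if i = j then [] else [T (prd i)])"
| "compl (T i) (S k) = (if k = 3 then [S k, T i] else [S k])"
| "compl (S k) (T i) = (if k = 3 then [T i, S k] else [T i])"
| "compl (S k) (S l) =
     (if k = l then [] else if k = Suc l \<or> l = Suc k then [S l, S k] else [S l])"

text \<open>Each pair of letters contributes the relation equating the two expressions of its least
  common multiple. Exchanging the letters reverses a step, so no symmetric closure is taken.\<close>

inductive step :: "cp_gen list \<Rightarrow> cp_gen list \<Rightarrow> bool" where
  "step (p @ x # compl x y @ q) (p @ y # compl y x @ q)"

definition cls :: "cp_gen list \<Rightarrow> cp_gen list set" where
  "cls w = {v. step\<^sup>*\<^sup>* w v}"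

text \<open>Letters act as functions on arbitrary sets of words, so the congruence becomes ordinary
  equational rewriting of nested applications.\<close>

definition act :: "cp_gen \<Rightarrow> cp_gen list set \<Rightarrow> cp_gen list set" where
  "act x A = (\<Union>v\<in>A. cls (x # v))"

abbreviation acts :: "cp_gen list \<Rightarrow> cp_gen list set \<Rightarrow> cp_gen list set" where
  "acts \<equiv> foldr act"

lemma compl_self [simp]: "compl x x = []"
  by (cases x) auto

lemma compl_eq_Nil_iff [simp]: "compl x y = [] \<longleftrightarrow> x = y"
  by (cases "(x, y)" rule: compl.cases) auto

lemma length_compl: "length (compl x y) = length (compl y x)"
  by (cases "(x, y)" rule: compl.cases) auto

lemma step_sym: "step u v \<Longrightarrow> step v u"
  by (auto elim!: step.cases intro: step.intros)

lemma step_length: "step u v \<Longrightarrow> length u = length v"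
  by (auto elim!: step.cases simp: length_compl)

lemma step_append: "step u v \<Longrightarrow> step (p @ u @ q) (p @ v @ q)"
proof (induction rule: step.induct)
  case (1 p' x y q')
  then show ?case
    using step.intros [of "p @ p'" x y "q' @ q"] by simp
qed

lemma steps_sym: "step\<^sup>*\<^sup>* u v \<Longrightarrow> step\<^sup>*\<^sup>* v u"
  by (induction rule: rtranclp_induct) (auto intro: step_sym converse_rtranclp_into_rtranclp)

lemma steps_length: "step\<^sup>*\<^sup>* u v \<Longrightarrow> length u = length v"
  by (induction rule: rtranclp_induct) (auto dest: step_length)

lemma steps_append: "step\<^sup>*\<^sup>* u v \<Longrightarrow> step\<^sup>*\<^sup>* (p @ u @ q) (p @ v @ q)"
proof (induction rule: rtranclp_induct)
  case (step y z)
  then show ?case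
    by (meson step_append rtranclp.rtrancl_into_rtrancl)
qed auto

lemma cls_eq_iff: "cls u = cls v \<longleftrightarrow> step\<^sup>*\<^sup>* u v"
proof
  assume "cls u = cls v"
  moreover have "v \<in> cls v"
    by (simp add: cls_def)
  ultimately show "step\<^sup>*\<^sup>* u v"
    by (auto simp: cls_def)
next
  assume "step\<^sup>*\<^sup>* u v"
  then show "cls u = cls v"
    unfolding cls_def using rtranclp_trans [of step] steps_sym by blast
qed

lemma cls_length: "cls u = cls v \<Longrightarrow> length u = length v"
  by (simp add: cls_eq_iff steps_length)

lemma cls_append: "cls u = cls v \<Longrightarrow> cls (p @ u @ q) = cls (p @ v @ q)"
  by (simp add: cls_eq_iff steps_append)

lemma cls_Cons: "cls u = cls v \<Longrightarrow> cls (x # u) = cls (x # v)"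
  using cls_append [of u v "[x]" "[]"] by simp

lemma in_cls_iff: "v \<in> cls u \<longleftrightarrow> cls v = cls u"
  unfolding cls_eq_iff by (auto simp: cls_def intro: steps_sym)

lemma act_cls: "act x (cls u) = cls (x # u)"
proof -
  have "u \<in> cls u"
    by (simp add: in_cls_iff)
  moreover have "cls (x # v) = cls (x # u)" if "v \<in> cls u" for v
    using that by (intro cls_Cons) (simp add: in_cls_iff)
  ultimately show ?thesis
    unfolding act_def by (metis (no_types, lifting) SUP_eq_const empty_iff)
qed

lemma acts_cls: "acts u (cls v) = cls (u @ v)"
  by (induction u) (auto simp: act_cls)

text \<open>For the empty word the left side would be \<open>A\<close> itself, which need not be
  closed under the congruence; a single letter already saturates it.\<close>

lemma acts_nonempty: "w \<noteq> [] \<Longrightarrow> acts w A = (\<Union>v\<in>A. cls (w @ v))"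
proof (induction w)
  case (Cons x w)
  show ?case
  proof (cases "w = []")
    case True
    then show ?thesis
      by (simp add: act_def)
  next
    case False
    have "act x (\<Union>v\<in>A. cls (w @ v)) = (\<Union>v\<in>A. act x (cls (w @ v)))"
      by (auto simp: act_def)
    then show ?thesis
      using Cons.IH False by (simp add: act_cls)
  qed
qed simp

lemma acts_cong: "cls u = cls v \<Longrightarrow> acts u A = acts v A"
proof (cases "u = []")
  case False
  assume eq: "cls u = cls v"
  then have "v \<noteq> []"
    using False cls_length [of u v] by auto
  moreover have "cls (u @ w) = cls (v @ w)" for w
    using cls_append [OF eq, of "[]" w] by simp
  ultimately show ?thesis
    using False by (simp add: acts_nonempty)
qed (use cls_length [of u v] in simp)

lemma act_compl: "act x (acts (compl x y) A) = act y (acts (compl y x) A)"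
proof -
  have "step (x # compl x y) (y # compl y x)"
    using step.intros [of "[]" x y "[]"] by simp
  then have "cls (x # compl x y) = cls (y # compl y x)"
    by (simp add: cls_eq_iff r_into_rtranclp)
  from acts_cong [OF this] show ?thesis
    by simp
qed

definition com :: "cp_gen \<Rightarrow> cp_gen \<Rightarrow> bool" where
  "com x y \<longleftrightarrow> compl x y = [y] \<and> compl y x = [x]"

definition brd :: "cp_gen \<Rightarrow> cp_gen \<Rightarrow> bool" where
  "brd x y \<longleftrightarrow> compl x y = [y, x] \<and> compl y x = [x, y]"

lemma com_act: "com x y \<Longrightarrow> act x (act y A) = act y (act x A)"
  using act_compl [of x y A] by (simp add: com_def)

lemma brd_act: "brd x y \<Longrightarrow> act x (act y (act x A)) = act y (act x (act y A))"
  using act_compl [of x y A] by (simp add: brd_def)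

abbreviation tp :: "nat \<Rightarrow> cp_gen" where "tp i \<equiv> T (prd i)"

lemma T_act: "act (T i) (act (tp i) A) = act (T j) (act (tp j) A)"
  using act_compl [of "T i" "T j" A] by (cases "i = j") auto

section \<open>The cube condition and least common multiples\<close>

text \<open>The induction hypothesis in Garside's argument: a common right multiple of
  \<open>x\<close> and \<open>y\<close> of length at most \<open>n\<close> is a multiple of the
  least one. For \<open>x = y\<close> this is left cancellation.\<close>

definition lcm_upto :: "nat \<Rightarrow> bool" where
  "lcm_upto n \<longleftrightarrow> (\<forall>x y u v. length u < n \<longrightarrow> act x (cls u) = act y (cls v) \<longrightarrow>
     (\<exists>w. cls u = acts (compl x y) (cls w) \<and> cls v = acts (compl y x) (cls w)))"

lemma lcm_uptoE:
  assumes "lcm_upto n" "length u < n" "act x (cls u) = act y (cls v)"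
  obtains w where "cls u = acts (compl x y) (cls w)" "cls v = acts (compl y x) (cls w)"
  using assms unfolding lcm_upto_def by blast

lemma lcm_upto_cancel:
  "lcm_upto n \<Longrightarrow> length u < n \<Longrightarrow> act x (cls u) = act x (cls v) \<Longrightarrow> cls u = cls v"
  by (erule (2) lcm_uptoE) simp

lemma lcm_upto_comE:
  assumes "lcm_upto n" "act x (cls u) = act y (cls v)" "length u < n" "com x y"
  obtains w where "cls u = act y (cls w)" "cls v = act x (cls w)" "length u = Suc (length w)"
    "length v = Suc (length w)"
proof -
  obtain w where "cls u = acts (compl x y) (cls w)" "cls v = acts (compl y x) (cls w)"
    using lcm_uptoE [OF assms(1,3,2)] .
  then have "cls u = cls (y # w)" "cls v = cls (x # w)"
    using assms(4) by (auto simp: com_def act_cls)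
  then show thesis
    using that cls_length [of u] cls_length [of v] by (simp add: act_cls)
qed

lemma lcm_upto_brdE:
  assumes "lcm_upto n" "act x (cls u) = act y (cls v)" "length u < n" "brd x y"
  obtains w where "cls u = act y (act x (cls w))" "cls v = act x (act y (cls w))"
    "length u = Suc (Suc (length w))" "length v = Suc (Suc (length w))"
proof -
  obtain w where "cls u = acts (compl x y) (cls w)" "cls v = acts (compl y x) (cls w)"
    using lcm_uptoE [OF assms(1,3,2)] .
  then have "cls u = cls (y # x # w)" "cls v = cls (x # y # w)"
    using assms(4) by (auto simp: brd_def act_cls)
  then show thesis
    using that cls_length [of u] cls_length [of v] by (simp add: act_cls)
qed

lemma lcm_upto_TE:
  assumes "lcm_upto n" "act (T i) (cls u) = act (T j) (cls v)" "length u < n" "i \<noteq> j"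
  obtains w where "cls u = act (tp i) (cls w)" "cls v = act (tp j) (cls w)"
    "length u = Suc (length w)" "length v = Suc (length w)"
proof -
  obtain w where "cls u = acts (compl (T i) (T j)) (cls w)" "cls v = acts (compl (T j) (T i)) (cls w)"
    using lcm_uptoE [OF assms(1,3,2)] .
  then have "cls u = cls (tp i # w)" "cls v = cls (tp j # w)"
    using assms(4) by (auto simp: act_cls)
  then show thesis
    using that cls_length [of u] cls_length [of v] by (simp add: act_cls)
qed

text \<open>This is the transitivity step of Garside's induction: chaining a common multiple of \<open>x\<close>, \<open>y\<close>
  with one of \<open>y\<close>, \<open>z\<close> yields one of \<open>x\<close>, \<open>z\<close> of the expected form.\<close>

definition cube :: "nat \<Rightarrow> cp_gen \<Rightarrow> cp_gen \<Rightarrow> cp_gen \<Rightarrow> bool" where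
  "cube n x y z \<longleftrightarrow> (\<forall>w w'. length (compl y x @ w) \<le> n \<longrightarrow>
     acts (compl y x) (cls w) = acts (compl y z) (cls w') \<longrightarrow>
     (\<exists>c. acts (compl x y) (cls w) = acts (compl x z) (cls c) \<and>
          acts (compl z y) (cls w') = acts (compl z x) (cls c)))"

lemma cubeI:
  assumes "\<And>w w'. length (compl y x @ w) \<le> n \<Longrightarrow> length (compl y x @ w) = length (compl y z @ w') \<Longrightarrow>
     acts (compl y x) (cls w) = acts (compl y z) (cls w') \<Longrightarrow>
     \<exists>c. acts (compl x y) (cls w) = acts (compl x z) (cls c) \<and>
          acts (compl z y) (cls w') = acts (compl z x) (cls c)"
  shows "cube n x y z"
  unfolding cube_def
proof (intro allI impI)
  fix w w'
  assume *: "length (compl y x @ w) \<le> n" "acts (compl y x) (cls w) = acts (compl y z) (cls w')"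
  then have "cls (compl y x @ w) = cls (compl y z @ w')"
    by (simp add: acts_cls)
  then show "\<exists>c. acts (compl x y) (cls w) = acts (compl x z) (cls c) \<and>
          acts (compl z y) (cls w') = acts (compl z x) (cls c)"
    using assms * cls_length by blast
qed

lemma cube_sym:
  assumes "cube n x y z"
  shows "cube n z y x"
proof (rule cubeI)
  fix w w'
  assume "length (compl y z @ w) \<le> n" "length (compl y z @ w) = length (compl y x @ w')"
    "acts (compl y z) (cls w) = acts (compl y x) (cls w')"
  then show "\<exists>c. acts (compl z y) (cls w) = acts (compl z x) (cls c) \<and>
          acts (compl x y) (cls w') = acts (compl x z) (cls c)"
    using assms unfolding cube_def by metis
qed

section \<open>The cube condition when each pair of letters commutes or braids\<close>

lemma com_sym: "com x y \<Longrightarrow> com y x"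
  by (simp add: com_def)

lemma brd_sym: "brd x y \<Longrightarrow> brd y x"
  by (simp add: brd_def)

text \<open>The names of this lemma and the next four give the types of the pairs
  \<open>x y\<close>, \<open>y z\<close>, \<open>x z\<close>, in this order. In each, the hypothesis
  is peeled letter by letter, and the witness completes \<open>x\<close> and
  \<open>compl x z\<close> to the least common multiple of the three letters.\<close>

lemma cube_com_com_com:
  assumes L: "lcm_upto n" and "com x y" "com y z" "com x z"
  shows "cube n x y z"
proof (rule cubeI)
  fix w w'
  assume *: "length (compl y x @ w) \<le> n" "length (compl y x @ w) = length (compl y z @ w')"
    "acts (compl y x) (cls w) = acts (compl y z) (cls w')"
  then have "act x (cls w) = act z (cls w')" "length w < n"
    using assms by (auto simp: com_def)
  then obtain w2 where w2: "cls w = act z (cls w2)" "cls w' = act x (cls w2)"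
    using lcm_upto_comE [OF L] assms by metis
  show "\<exists>c. acts (compl x y) (cls w) = acts (compl x z) (cls c) \<and>
          acts (compl z y) (cls w') = acts (compl z x) (cls c)"
    using assms com_act [OF assms(2)] com_act [OF assms(3)] com_act [OF assms(4)]
    by (intro exI [of _ "y # w2"]) (simp add: w2 com_def flip: act_cls)
qed

lemma cube_brd_com_com:
  assumes L: "lcm_upto n" and "brd x y" "com y z" "com x z"
  shows "cube n x y z"
proof (rule cubeI)
  fix w w'
  assume *: "length (compl y x @ w) \<le> n" "length (compl y x @ w) = length (compl y z @ w')"
    "acts (compl y x) (cls w) = acts (compl y z) (cls w')"
  then have "act x (cls (y # w)) = act z (cls w')" "length (y # w) < n"
    using assms by (auto simp: com_def brd_def act_cls)
  then obtain w1 where w1: "act y (cls w) = act z (cls w1)" "cls w' = act x (cls w1)"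
    using lcm_upto_comE [OF L] assms by (metis act_cls)
  then obtain w2 where w2: "cls w = act z (cls w2)" "cls w1 = act y (cls w2)"
    using lcm_upto_comE [OF L w1(1)] assms \<open>length (y # w) < n\<close> by (metis Suc_lessD length_Cons)
  show "\<exists>c. acts (compl x y) (cls w) = acts (compl x z) (cls c) \<and>
          acts (compl z y) (cls w') = acts (compl z x) (cls c)"
    using assms com_act [OF assms(3)] com_act [OF assms(4)] brd_act [OF assms(2)]
    by (intro exI [of _ "y # x # w2"]) (simp add: w1 w2 com_def brd_def flip: act_cls)
qed

lemma cube_com_com_brd:
  assumes L: "lcm_upto n" and "com x y" "com y z" "brd x z"
  shows "cube n x y z"
proof (rule cubeI)
  fix w w'
  assume *: "length (compl y x @ w) \<le> n" "length (compl y x @ w) = length (compl y z @ w')"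
    "acts (compl y x) (cls w) = acts (compl y z) (cls w')"
  then have "act x (cls w) = act z (cls w')" "length w < n"
    using assms by (auto simp: com_def)
  then obtain w2 where w2: "cls w = act z (act x (cls w2))" "cls w' = act x (act z (cls w2))"
    using lcm_upto_brdE [OF L] assms by metis
  show "\<exists>c. acts (compl x y) (cls w) = acts (compl x z) (cls c) \<and>
          acts (compl z y) (cls w') = acts (compl z x) (cls c)"
    using assms com_act [OF com_sym, OF assms(2)] com_act [OF assms(3)]
    by (intro exI [of _ "y # w2"]) (simp add: w2 com_def brd_def flip: act_cls)
qed

lemma cube_brd_brd_com:
  assumes L: "lcm_upto n" and "brd x y" "brd y z" "com x z"
  shows "cube n x y z"
proof (rule cubeI)
  fix w w'
  assume *: "length (compl y x @ w) \<le> n" "length (compl y x @ w) = length (compl y z @ w')"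
    "acts (compl y x) (cls w) = acts (compl y z) (cls w')"
  then have 0: "act x (cls (y # w)) = act z (cls (y # w'))" "length (y # w) < n" "length w = length w'"
    using assms by (auto simp: com_def brd_def act_cls)
  then obtain w1 where w1: "act y (cls w) = act z (cls w1)" "act y (cls w') = act x (cls w1)"
    and l1: "length w = length w1"
    using lcm_upto_comE [OF L 0(1,2)] assms by (metis act_cls length_Cons Suc_inject)
  obtain w2 where w2: "cls w = act z (act y (cls w2))" "cls w1 = act y (act z (cls w2))"
    using lcm_upto_brdE [OF L w1(1)] assms 0 by (metis Suc_lessD length_Cons)
  obtain w3 where w3: "cls w' = act x (act y (cls w3))" "cls w1 = act y (act x (cls w3))"
    using lcm_upto_brdE [OF L w1(2)] assms 0 brd_sym by (metis Suc_lessD length_Cons)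
  \<comment> \<open>Both decompositions of \<open>w1\<close> begin with \<open>y\<close>; without it
    they exhibit a common multiple of \<open>z\<close> and \<open>x\<close>.\<close>
  have "act y (cls (z # w2)) = act y (cls (x # w3))"
    using w2 w3 by (simp add: act_cls)
  moreover have "length (z # w2) < n"
    using l1 0 cls_length [of w1 "y # z # w2"] w2 by (simp add: act_cls)
  ultimately have "cls (z # w2) = cls (x # w3)"
    using lcm_upto_cancel [OF L] by blast
  then obtain w4 where w4: "cls w2 = act x (cls w4)" "cls w3 = act z (cls w4)"
    using lcm_upto_comE [OF L, of z w2 x w3] \<open>length (z # w2) < n\<close> assms com_sym by (metis act_cls Suc_lessD length_Cons)
  \<comment> \<open>Preceded by \<open>x\<close> and by \<open>z\<close> respectively, these
    identities compare positive words for the half twist on four strands.\<close>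
  have "act y (act x (act z (act y (act x A)))) = act z (act y (act x (act z (act y A))))"
    "act y (act z (act x (act y (act z A)))) = act x (act y (act z (act x (act y A))))" for A
    by (metis com_act [OF assms(4)] brd_act [OF assms(2)] brd_act [OF assms(3)])+
  then show "\<exists>c. acts (compl x y) (cls w) = acts (compl x z) (cls c) \<and>
          acts (compl z y) (cls w') = acts (compl z x) (cls c)"
    using assms com_act [OF assms(4)]
    by (intro exI [of _ "y # z # x # y # w4"]) (simp add: w1 w2 w3 w4 com_def brd_def flip: act_cls)
qed

lemma cube_brd_com_brd:
  assumes L: "lcm_upto n" and "brd x y" "com y z" "brd x z"
  shows "cube n x y z"
proof (rule cubeI)
  fix w w'
  assume *: "length (compl y x @ w) \<le> n" "length (compl y x @ w) = length (compl y z @ w')"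
    "acts (compl y x) (cls w) = acts (compl y z) (cls w')"
  then have 0: "act x (cls (y # w)) = act z (cls w')" "length (y # w) < n"
    using assms by (auto simp: com_def brd_def act_cls)
  then obtain w1 where w1: "cls (y # w) = cls (z # x # w1)" "cls w' = act x (act z (cls w1))"
    using lcm_upto_brdE [OF L 0] assms by (metis act_cls)
  then have "act y (cls w) = act z (cls (x # w1))" "length w < n"
    using 0 by (auto simp: act_cls)
  then obtain w2 where w2: "cls w = act z (cls w2)" "cls (x # w1) = cls (y # w2)"
    using lcm_upto_comE [OF L] assms by (metis act_cls)
  have "length w1 < n"
    using 0 w1 cls_length [of "y # w" "z # x # w1"] by simp
  then obtain w3 where w3: "cls w2 = act x (act y (cls w3))" "cls w1 = act y (act x (cls w3))"
    using lcm_upto_brdE [OF L, of x w1 y w2] w2 assms by (metis act_cls)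
  have "act y (act x (act z (act x (act y A)))) = act z (act x (act y (act x (act z A))))"
    "act y (act x (act z (act y (act x A)))) = act x (act z (act y (act x (act z A))))" for A
    by (metis com_act [OF assms(3)] brd_act [OF assms(2)] brd_act [OF assms(4)])+
  then show "\<exists>c. acts (compl x y) (cls w) = acts (compl x z) (cls c) \<and>
          acts (compl z y) (cls w') = acts (compl z x) (cls c)"
    using assms
    by (intro exI [of _ "y # x # z # w3"]) (simp add: w1 w2 w3 com_def brd_def flip: act_cls)
qed

section \<open>The cube condition for triples with at least two letters \<open>T i\<close>\<close>

lemma brd_T: "brd (T i) (S 3)" "brd (S 3) (T i)"
  by (auto simp: brd_def)

lemma com_T: "k \<noteq> 3 \<Longrightarrow> com (T i) (S k)" "k \<noteq> 3 \<Longrightarrow> com (S k) (T i)"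
  by (auto simp: com_def)

lemma com_S: "k \<noteq> l \<Longrightarrow> k \<noteq> Suc l \<Longrightarrow> l \<noteq> Suc k \<Longrightarrow> com (S k) (S l)"
  by (auto simp: com_def)

lemma brd_S: "brd (S k) (S (Suc k))" "brd (S (Suc k)) (S k)"
  by (auto simp: brd_def)

lemma S3_T_braid: "act (S 3) (act (T i) (act (S 3) A)) = act (T i) (act (S 3) (act (T i) A))"
  by (rule brd_act) (rule brd_T)

abbreviation tpp :: "nat \<Rightarrow> cp_gen" where "tpp i \<equiv> tp (prd i)"

lemma prd_eq_iff [simp]: "prd i = prd j \<longleftrightarrow> i = j"
  using e_ge by (auto simp: prd_def)

lemma prd_neq [simp]: "prd i \<noteq> i" "i \<noteq> prd i"
  using e_ge by (auto simp: prd_def)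

text \<open>The pair \<open>T i\<close>, \<open>tp i\<close> is the same element for every
  \<open>i\<close>, so it may be taken to start at \<open>prd j\<close>. Two braid moves then carry
  the last letter to the front, its index going from \<open>prd (prd j)\<close> to
  \<open>prd j\<close>.\<close>

lemma Delta_shift: "act (S 3) (act (T i) (act (tp i) (act (S 3) (act (tpp j) A)))) =
   act (tp j) (act (S 3) (act (T i) (act (tp i) (act (S 3) A))))"
proof -
  have "act (S 3) (act (T i) (act (tp i) (act (S 3) (act (tpp j) A)))) =
    act (S 3) (act (tp j) (act (tpp j) (act (S 3) (act (tpp j) A))))"
    by (simp only: T_act [of i _ "prd j"])
  also have "\<dots> = act (S 3) (act (tp j) (act (S 3) (act (tpp j) (act (S 3) A))))"
    by (simp only: S3_T_braid [of "prd (prd j)"])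
  also have "\<dots> = act (tp j) (act (S 3) (act (tp j) (act (tpp j) (act (S 3) A))))"
    by (simp only: S3_T_braid [of "prd j"])
  also have "\<dots> = act (tp j) (act (S 3) (act (T i) (act (tp i) (act (S 3) A))))"
    by (simp only: T_act [of i _ "prd j"])
  finally show ?thesis .
qed

text \<open>The complement of \<open>T j\<close> in another \<open>T i\<close> is
  \<open>tp j\<close>, whatever \<open>i\<close> is, so both sides of the hypothesis start with the
  same letter.\<close>

lemma cube_T_T_T:
  assumes L: "lcm_upto n" and "i \<noteq> j" "j \<noteq> k" "i \<noteq> k"
  shows "cube n (T i) (T j) (T k)"
proof (rule cubeI)
  fix w w'
  assume *: "length (compl (T j) (T i) @ w) \<le> n"
    "length (compl (T j) (T i) @ w) = length (compl (T j) (T k) @ w')"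
    "acts (compl (T j) (T i)) (cls w) = acts (compl (T j) (T k)) (cls w')"
  then have "act (tp j) (cls w) = act (tp j) (cls w')" "length w < n"
    using assms by auto
  then have "cls w = cls w'"
    using lcm_upto_cancel [OF L] by blast
  then show "\<exists>c. acts (compl (T i) (T j)) (cls w) = acts (compl (T i) (T k)) (cls c) \<and>
          acts (compl (T k) (T j)) (cls w') = acts (compl (T k) (T i)) (cls c)"
    using assms by (intro exI [of _ w]) simp
qed

lemma cube_T_S_T:
  assumes L: "lcm_upto n" and "i \<noteq> j" "k \<noteq> 3"
  shows "cube n (T i) (S k) (T j)"
proof (rule cubeI)
  fix w w'
  assume *: "length (compl (S k) (T i) @ w) \<le> n"
    "length (compl (S k) (T i) @ w) = length (compl (S k) (T j) @ w')"
    "acts (compl (S k) (T i)) (cls w) = acts (compl (S k) (T j)) (cls w')"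
  then have "act (T i) (cls w) = act (T j) (cls w')" "length w < n"
    using assms by auto
  then obtain c where c: "cls w = act (tp i) (cls c)" "cls w' = act (tp j) (cls c)"
    using lcm_upto_TE [OF L] assms by metis
  show "\<exists>c. acts (compl (T i) (S k)) (cls w) = acts (compl (T i) (T j)) (cls c) \<and>
          acts (compl (T j) (S k)) (cls w') = acts (compl (T j) (T i)) (cls c)"
    using assms com_act [OF com_T(1), OF assms(3)]
    by (intro exI [of _ "S k # c"]) (simp add: c flip: act_cls)
qed

lemma cube_T_T_S:
  assumes L: "lcm_upto n" and "i \<noteq> j" "k \<noteq> 3"
  shows "cube n (T i) (T j) (S k)"
proof (rule cubeI)
  fix w w'
  assume *: "length (compl (T j) (T i) @ w) \<le> n"
    "length (compl (T j) (T i) @ w) = length (compl (T j) (S k) @ w')"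
    "acts (compl (T j) (T i)) (cls w) = acts (compl (T j) (S k)) (cls w')"
  then have "act (tp j) (cls w) = act (S k) (cls w')" "length w < n"
    using assms by auto
  then obtain c where c: "cls w = act (S k) (cls c)" "cls w' = act (tp j) (cls c)"
    using lcm_upto_comE [OF L] com_T assms by metis
  show "\<exists>c. acts (compl (T i) (T j)) (cls w) = acts (compl (T i) (S k)) (cls c) \<and>
          acts (compl (S k) (T j)) (cls w') = acts (compl (S k) (T i)) (cls c)"
    using assms com_act [OF com_T(1), OF assms(3)] T_act [of j "cls c" i]
    by (intro exI [of _ "tp i # c"]) (simp add: c flip: act_cls)
qed


lemma cube_T_S3_T:
  assumes L: "lcm_upto n" and "i \<noteq> j"
  shows "cube n (T i) (S 3) (T j)"
proof (rule cubeI)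
  fix w w'
  assume *: "length (compl (S 3) (T i) @ w) \<le> n"
    "length (compl (S 3) (T i) @ w) = length (compl (S 3) (T j) @ w')"
    "acts (compl (S 3) (T i)) (cls w) = acts (compl (S 3) (T j)) (cls w')"
  then have 0: "act (T i) (cls (S 3 # w)) = act (T j) (cls (S 3 # w'))"
    "length w + 1 < n" "length w = length w'"
    using assms by (auto simp: act_cls)
  then obtain v where v: "act (S 3) (cls w) = act (tp i) (cls v)" "act (S 3) (cls w') = act (tp j) (cls v)"
    using lcm_upto_TE [OF L 0(1)] assms by (metis act_cls length_Cons Suc_eq_plus1)
  obtain a where a: "cls w = act (tp i) (act (S 3) (cls a))" "cls v = act (S 3) (act (tp i) (cls a))"
    and la: "length w = Suc (Suc (length a))"
    using lcm_upto_brdE [OF L v(1)] brd_T 0 by (metis add_lessD1)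
  obtain b where b: "cls w' = act (tp j) (act (S 3) (cls b))" "cls v = act (S 3) (act (tp j) (cls b))"
    using lcm_upto_brdE [OF L v(2)] brd_T 0 by (metis add_lessD1)
  have "act (S 3) (cls (tp i # a)) = act (S 3) (cls (tp j # b))"
    using a b by (simp add: act_cls)
  moreover have "length (tp i # a) < n" "length a < n"
    using la 0 by auto
  ultimately have ab: "act (tp i) (cls a) = act (tp j) (cls b)"
    using lcm_upto_cancel [OF L, of "tp i # a"] unfolding act_cls by blast
  obtain c where c: "cls a = act (tpp i) (cls c)" "cls b = act (tpp j) (cls c)"
    using lcm_upto_TE [OF L ab \<open>length a < n\<close>] assms(2) by (metis prd_eq_iff)
  \<comment> \<open>The common multiple of the triple is \<open>T i\<close>, \<open>tp i\<close>,
    \<open>S 3\<close> written twice in a row; the witness is what follows its first two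
    letters.\<close>
  show "\<exists>c. acts (compl (T i) (S 3)) (cls w) = acts (compl (T i) (T j)) (cls c) \<and>
          acts (compl (T j) (S 3)) (cls w') = acts (compl (T j) (T i)) (cls c)"
    using assms
    by (intro exI [of _ "S 3 # T i # tp i # S 3 # c"])
      (simp add: a b c Delta_shift T_act [of i _ j] flip: act_cls)
qed

lemma cube_T_T_S3:
  assumes L: "lcm_upto n" and "i \<noteq> j"
  shows "cube n (T j) (T i) (S 3)"
proof (rule cubeI)
  fix w w'
  assume *: "length (compl (T i) (T j) @ w) \<le> n"
    "length (compl (T i) (T j) @ w) = length (compl (T i) (S 3) @ w')"
    "acts (compl (T i) (T j)) (cls w) = acts (compl (T i) (S 3)) (cls w')"
  then have 0: "act (tp i) (cls w) = act (S 3) (cls (T i # w'))"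
    "length w < n" "length w = Suc (length w')"
    using assms by (auto simp: act_cls)
  obtain v where v: "cls w = act (S 3) (act (tp i) (cls v))" "act (T i) (cls w') = act (tp i) (cls (S 3 # v))"
    and lv: "length w = Suc (Suc (length v))"
    using lcm_upto_brdE [OF L 0(1,2)] brd_T by (metis act_cls)
  have lw': "length w' < n"
    using 0 by simp
  obtain c where c: "cls w' = act (tp i) (cls c)" "act (S 3) (cls v) = act (tpp i) (cls c)"
    using lcm_upto_TE [OF L v(2) lw'] by (metis act_cls prd_neq(2))
  obtain d where d: "cls v = act (tpp i) (act (S 3) (cls d))" "cls c = act (S 3) (act (tpp i) (cls d))"
    using lcm_upto_brdE [OF L c(2)] brd_T lv 0(2) by (metis Suc_lessD)
  \<comment> \<open>One braid move creates the two pairs \<open>T i\<close>, \<open>tp i\<close> and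
    \<open>tp i\<close>, \<open>tpp i\<close>, each of which may change its index
    separately.\<close>
  have "act (T i) (act (S 3) (act (tp i) (act (S 3) (act (tpp i) A)))) =
    act (T j) (act (tp j) (act (S 3) (act (tp j) (act (tpp j) A))))" for A
  proof -
    have "act (T i) (act (S 3) (act (tp i) (act (S 3) (act (tpp i) A)))) =
      act (T i) (act (tp i) (act (S 3) (act (tp i) (act (tpp i) A))))"
      by (simp only: S3_T_braid)
    then show ?thesis
      by (simp only: T_act [of i _ j] T_act [of "prd i" _ "prd j"])
  qed
  then show "\<exists>c. acts (compl (T j) (T i)) (cls w) = acts (compl (T j) (S 3)) (cls c) \<and>
          acts (compl (S 3) (T i)) (cls w') = acts (compl (S 3) (T j)) (cls c)"
    using assms Delta_shift [of j j] T_act [of "prd i" _ j] S3_T_braid [of "prd j"]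
    by (intro exI [of _ "tp j # S 3 # tpp j # d"]) (simp add: v c d flip: act_cls)
qed

text \<open>A derivation may return to an earlier first letter, so the case of equal outer letters
  is needed. It is cancellation of \<open>compl y x\<close>, letter by letter.\<close>

lemma cube_same: "lcm_upto n \<Longrightarrow> x \<noteq> y \<Longrightarrow> cube n x y x"
proof (rule cubeI)
  fix w w'
  assume L: "lcm_upto n" and "x \<noteq> y" and
    *: "length (compl y x @ w) \<le> n" "acts (compl y x) (cls w) = acts (compl y x) (cls w')"
  have "cls w = cls w'" if "length (p @ w) \<le> n" "cls (p @ w) = cls (p @ w')" for p
    using that
  proof (induction p)
    case (Cons x p)
    then show ?case
      using lcm_upto_cancel [OF L, of "p @ w" x "p @ w'"] by (simp add: act_cls)
  qed simp
  then have "cls w = cls w'"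
    using * by (metis acts_cls)
  then show "\<exists>c. acts (compl x y) (cls w) = acts (compl x x) (cls c) \<and>
      acts (compl x y) (cls w') = acts (compl x x) (cls c)"
    by (intro exI [of _ "compl x y @ w"]) (simp flip: acts_cls)
qed

lemma com_or_brd_S: "k \<noteq> l \<Longrightarrow> com (S k) (S l) \<or> brd (S k) (S l)"
  by (auto simp: com_def brd_def)

lemma com_or_brd_T: "com (T i) (S k) \<or> brd (T i) (S k)"
  by (auto simp: com_def brd_def)

text \<open>In the graph of braid relations the letters \<open>S k\<close> form a path and each
  \<open>T i\<close> is attached to \<open>S 3\<close> only. Hence the five lemmas above cover, up
  to exchanging the outer letters, all triples of commuting or braided pairs.\<close>

lemma brd_triangle_free: "brd x y \<Longrightarrow> brd y z \<Longrightarrow> brd x z \<Longrightarrow> False"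
  by (cases x; cases y; cases z) (auto simp: brd_def split: if_splits)

lemma cube_com_or_brd:
  assumes "lcm_upto n" "com x y \<or> brd x y" "com y z \<or> brd y z" "com x z \<or> brd x z"
  shows "cube n x y z"
  using assms cube_com_com_com cube_brd_com_com cube_com_com_brd cube_brd_brd_com
    cube_brd_com_brd brd_triangle_free cube_sym com_sym brd_sym by metis

lemma cube_distinct:
  assumes L: "lcm_upto n" and "x \<noteq> y" "y \<noteq> z" "x \<noteq> z"
  shows "cube n x y z"
proof -
  have TST: "cube n (T i) (S k) (T j)" if "i \<noteq> j" for i j k
    using cube_T_S_T [OF L that] cube_T_S3_T [OF L that] by (cases "k = 3") auto
  have TTS: "cube n (T i) (T j) (S k)" if "i \<noteq> j" for i j k
    using cube_T_T_S [OF L that] cube_T_T_S3 [OF L not_sym [OF that]] by (cases "k = 3") auto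
  have ST: "com (S k) (T i) \<or> brd (S k) (T i)" for i k
    using com_or_brd_T com_sym brd_sym by blast
  note cb = cube_com_or_brd [OF L]
  show ?thesis
  proof (cases x)
    case x: (T i)
    show ?thesis
    proof (cases y)
      case y: (T j)
      show ?thesis
        using cube_T_T_T [OF L] TTS assms x y by (cases z) auto
    next
      case y: (S k)
      show ?thesis
      proof (cases z)
        case (T j)
        then show ?thesis
          using TST assms x y by simp
      next
        case z: (S l)
        then show ?thesis
          using assms unfolding x y z by (intro cb com_or_brd_T com_or_brd_S) auto
      qed
    qed
  next
    case x: (S k)
    show ?thesis
    proof (cases y)
      case y: (T i)
      show ?thesis
      proof (cases z)
        case (T j)
        then show ?thesis
          using cube_sym [OF TTS] assms x y by simp
      next
        case z: (S l)
        then show ?thesis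
          using assms unfolding x y z by (intro cb ST com_or_brd_T com_or_brd_S) auto
      qed
    next
      case y: (S l)
      show ?thesis
      proof (cases z)
        case z: (T j)
        then show ?thesis
          using assms unfolding x y z by (intro cb ST com_or_brd_S) auto
      next
        case z: (S m)
        then show ?thesis
          using assms unfolding x y z by (intro cb com_or_brd_S) auto
      qed
    qed
  qed
qed

text \<open>Induction on the length. A single step either rewrites at the front, which exhibits both
  complements, or keeps the first letter. The cube condition, available from the induction
  hypothesis, composes the steps of a derivation.\<close>

theorem lcm_letters:
  assumes "act x (cls u) = act y (cls v)"
  obtains w where "cls u = acts (compl x y) (cls w)" "cls v = acts (compl y x) (cls w)"
proof -
  have "lcm_upto n" for n
  proof (induction n)
    case 0
    then show ?case
      by (simp add: lcm_upto_def)
  next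
    case (Suc n)
    have cube: "cube n x y z" if "x \<noteq> y" "y \<noteq> z" for x y z
      using cube_same cube_distinct Suc.IH that by (cases "x = z") auto
    define Q where "Q x u y v \<longleftrightarrow> (\<exists>w. cls u = acts (compl x y) (cls w) \<and> cls v = acts (compl y x) (cls w))"
      for x u y v
    have Q_trans: "Q x u z t" if q: "Q x u y v" "Q y v z t" "length v \<le> n" for x u y v z t
    proof (cases "x = y \<or> y = z")
      case True
      then show ?thesis
        using q by (auto simp: Q_def)
    next
      case False
      obtain w where w: "cls u = acts (compl x y) (cls w)" "cls v = acts (compl y x) (cls w)"
        using q(1) unfolding Q_def by blast
      obtain w' where w': "cls v = acts (compl y z) (cls w')" "cls t = acts (compl z y) (cls w')"
        using q(2) unfolding Q_def by blast
      have "length (compl y x @ w) \<le> n"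
        using w(2) q(3) cls_length [of v "compl y x @ w"] by (simp add: acts_cls)
      then obtain c where "acts (compl x y) (cls w) = acts (compl x z) (cls c)"
          "acts (compl z y) (cls w') = acts (compl z x) (cls c)"
        using cube [of x y z] False w w' unfolding cube_def by metis
      then show ?thesis
        unfolding Q_def using w w' by metis
    qed
    have Q_step: "Q x u y v" if "step (x # u) (y # v)" for x u y v
      using that
    proof cases
      case (1 p x' y' q)
      show ?thesis
      proof (cases p)
        case Nil
        with 1 show ?thesis
          unfolding Q_def by (auto simp: acts_cls)
      next
        case (Cons a p')
        with 1 have "x = y" "step u v"
          by (auto intro: step.intros)
        then have "cls u = cls v"
          by (simp add: cls_eq_iff r_into_rtranclp)
        then show ?thesis
          unfolding Q_def using \<open>x = y\<close> by auto
      qed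
    qed
    have "Q x u y v" if "length u = n" "step\<^sup>*\<^sup>* (x # u) (y # v)" for x u y v
      using that(2)
    proof (induction "y # v" arbitrary: y v rule: rtranclp_induct)
      case base
      then show ?case
        unfolding Q_def by auto
    next
      case (step b)
      obtain y' v' where b: "b = y' # v'"
        using steps_length [OF step(1)] by (cases b) auto
      then have "length v' = n"
        using steps_length [OF step(1)] that(1) by simp
      moreover have "Q x u y' v'"
        using step(3) b by simp
      moreover have "Q y' v' y v"
        using Q_step step(2) b by simp
      ultimately show ?case
        using Q_trans [of x u y' v' y v] by simp
    qed
    then have "Q x u y v" if "length u = n" "act x (cls u) = act y (cls v)" for x u y v
      using that by (simp add: act_cls cls_eq_iff)
    then show ?case
      using Suc.IH unfolding lcm_upto_def Q_def less_Suc_eq by blast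
  qed
  then show thesis
    using that assms by (metis lcm_uptoE lessI)
qed

lemma cancel: "act x (cls u) = act x (cls v) \<Longrightarrow> cls u = cls v"
  by (erule lcm_letters) simp

lemma cancel_acts: "acts p (cls u) = acts p (cls v) \<Longrightarrow> cls u = cls v"
proof (induction p)
  case (Cons x p)
  then show ?case
    using cancel [of x "p @ u" "p @ v"] by (simp add: acts_cls)
qed simp


section \<open>A central multiple of all letters\<close>

lemma prd_less [simp]: "i < e \<Longrightarrow> prd i < e"
  by (auto simp: prd_def)

lemma prd_pow_less [simp]: "i < e \<Longrightarrow> (prd ^^ k) i < e"
  by (induction k) auto

lemma prd_simps: "prd (Suc 0) = 0" "prd 1 = 0"
  using e_ge by (auto simp: prd_def)

lemma prd_surj:
  assumes "i < e"
  obtains j where "j < e" "i = prd j"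
proof (cases "Suc i < e")
  case True
  then show thesis
    using that [of "Suc i"] by (simp add: prd_def)
next
  case False
  then show thesis
    using that [of 0] assms by (simp add: prd_def)
qed

text \<open>Subtraction of \<open>k\<close> modulo \<open>e\<close> appears as addition of
  \<open>k * (e - 1)\<close> to stay within the natural numbers.\<close>

lemma prd_pow: "i < e \<Longrightarrow> (prd ^^ k) i = (i + k * (e - 1)) mod e"
proof (induction k)
  case (Suc k)
  have *: "prd j = (j + (e - 1)) mod e" if "j < e" for j
    using that by (cases j) (auto simp: prd_def)
  have "(prd ^^ Suc k) i = ((i + k * (e - 1)) mod e + (e - 1)) mod e"
    using Suc * [of "(i + k * (e - 1)) mod e"] by simp
  then show ?case
    by (simp add: mod_simps add_ac)
qed simp

lemma prd_pow_period: "i < e \<Longrightarrow> (prd ^^ (e * k)) i = i"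
  by (simp add: prd_pow mult.assoc)

abbreviation Delta :: "cp_gen list" where "Delta \<equiv> [T 1, T 0]"

lemma Delta_eq: "act (T 1) (act (T 0) A) = act (T i) (act (tp i) A)"
  using T_act [of 1 A i] prd_simps by simp

text \<open>The product of \<open>T i\<close>, \<open>tp i\<close>, \<open>tpp i\<close> contains
  \<open>Delta\<close> both as its first two and as its last two letters.\<close>

lemma Delta_T: "acts Delta (act (tpp i) A) = act (T i) (acts Delta A)"
proof -
  have "acts Delta (act (tpp i) A) = act (T i) (act (tp i) (act (tpp i) A))"
    using Delta_eq [of _ i] by simp
  also have "\<dots> = act (T i) (acts Delta A)"
    using Delta_eq [of _ "prd i"] by simp
  finally show ?thesis .
qed

text \<open>Analogues of the Jucys--Murphy elements; their product is quasi-central.\<close>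

fun jm :: "nat \<Rightarrow> cp_gen list" where
  "jm 0 = Delta"
| "jm (Suc n) = S (n + 3) # jm n @ [S (n + 3)]"

text \<open>For \<open>n = 1\<close> this is \<open>Delta_shift\<close>; the outer letters added
  later commute with every \<open>T i\<close>. The shift is by one, whereas \<open>jm 0\<close>
  shifts by two.\<close>

lemma jm_T: "0 < n \<Longrightarrow> i < e \<Longrightarrow> acts (jm n) (act (tp i) A) = act (T i) (acts (jm n) A)"
proof (induction n arbitrary: A)
  case (Suc n)
  obtain j where j: "i = prd j"
    using prd_surj Suc.prems by metis
  show ?case
  proof (cases "n = 0")
    case True
    then show ?thesis
      using Delta_shift [of 1 j A] prd_simps by (simp add: j)
  next
    case False
    then have "com (S (n + 3)) (T i)" "com (S (n + 3)) (tp i)"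
      by (auto intro: com_T)
    from this [THEN com_act] show ?thesis
      using Suc False by simp
  qed
qed simp

lemma jm_S_less: "m < n \<Longrightarrow> act (S (n + 3)) (acts (jm m) A) = acts (jm m) (act (S (n + 3)) A)"
proof (induction m arbitrary: A)
  case 0
  then have "com (S (n + 3)) (T i)" for i
    by (auto intro: com_T)
  then show ?case
    using com_act by simp
next
  case (Suc m)
  then have "com (S (n + 3)) (S (m + 3))"
    by (auto intro: com_S)
  then show ?case
    using Suc com_act by simp
qed

text \<open>In \<open>jm (n + 2)\<close> the letter passes the left outer letters by a braid move,
  becoming \<open>S (n + 4)\<close>; this commutes with \<open>jm n\<close>, and a braid move on the
  right restores \<open>S (n + 3)\<close>. Outer letters of larger index commute with it.\<close>

lemma jm_S_greater:
  "n + 2 \<le> m \<Longrightarrow> act (S (n + 3)) (acts (jm m) A) = acts (jm m) (act (S (n + 3)) A)"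
proof (induction m arbitrary: A rule: dec_induct)
  case base
  have "acts (jm (n + 2)) A = act (S (n + 4)) (act (S (n + 3)) (acts (jm n) (act (S (n + 3)) (act (S (n + 4)) A))))" for A
    by (simp add: numeral_eq_Suc)
  moreover have "act (S (n + 4)) (acts (jm n) B) = acts (jm n) (act (S (n + 4)) B)" for B
    using jm_S_less [of n "Suc n"] by (simp add: numeral_eq_Suc)
  moreover have "act (S (n + 3)) (act (S (n + 4)) (act (S (n + 3)) B)) =
      act (S (n + 4)) (act (S (n + 3)) (act (S (n + 4)) B))" for B
    using brd_act [OF brd_S(1) [of "n + 3"]] by (simp add: numeral_eq_Suc)
  ultimately show ?case
    by simp
next
  case (step m)
  then have "com (S (n + 3)) (S (m + 3))"
    by (auto intro: com_S)
  then show ?case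
    using step com_act by simp
qed

text \<open>For \<open>k = 0\<close>, \<open>Delta\<close> is written as \<open>T 0\<close>,
  \<open>tp 0\<close>; the shift by one turns this pair into \<open>T 1\<close>, \<open>T 0\<close>,
  which is \<open>Delta\<close> again. The outer letters of \<open>jm k\<close> pass by
  \<open>jm_S_greater\<close>.\<close>

lemma jm_jm: "k < m \<Longrightarrow> acts (jm m) (acts (jm k) A) = acts (jm k) (acts (jm m) A)"
proof (induction k arbitrary: A)
  case 0
  have "acts (jm m) (act (T 1) (act (T 0) A)) = acts (jm m) (act (tp 1) (act (tp 0) A))"
    using Delta_eq [of A 0] prd_simps by simp
  also have "\<dots> = act (T 1) (act (T 0) (acts (jm m) A))"
    using jm_T 0 e_ge by simp
  finally show ?case
    by simp
next
  case (Suc k)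
  then have "acts (jm m) (act (S (k + 3)) B) = act (S (k + 3)) (acts (jm m) B)" for B
    by (intro jm_S_greater [symmetric]) auto
  then show ?case
    using Suc by simp
qed

definition Lam :: "nat \<Rightarrow> cp_gen list" where
  "Lam N = concat (map jm [0..<N])"

lemma Lam_0 [simp]: "Lam 0 = []"
  by (simp add: Lam_def)

lemma Lam_Suc [simp]: "Lam (Suc N) = Lam N @ jm N"
  by (simp add: Lam_def)

text \<open>\<open>Delta\<close> shifts the index by two and each of the remaining
  \<open>N - 1\<close> factors by one, in total \<open>Suc N\<close>.\<close>

lemma Lam_T:
  "0 < N \<Longrightarrow> i < e \<Longrightarrow> acts (Lam N) (act (T ((prd ^^ Suc N) i)) A) = act (T i) (acts (Lam N) A)"
proof (induction N arbitrary: A)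
  case (Suc N)
  show ?case
  proof (cases "N = 0")
    case True
    then show ?thesis
      using Delta_T [of i] by simp
  next
    case False
    have "acts (jm N) (act (tp ((prd ^^ Suc N) i)) A) = act (T ((prd ^^ Suc N) i)) (acts (jm N) A)"
      using False Suc.prems by (intro jm_T) simp_all
    then show ?thesis
      using Suc False by simp
  qed
qed simp

lemma Lam_jm: "n < N \<Longrightarrow> acts (jm n) (acts (Lam n) A) = acts (Lam n) (acts (jm n) A)"
proof -
  have "m \<le> n \<Longrightarrow> acts (jm n) (acts (Lam m) A) = acts (Lam m) (acts (jm n) A)" for m A
    by (induction m arbitrary: A) (simp_all add: jm_jm)
  then show ?thesis
    by simp
qed

text \<open>All factors commute with the letter except \<open>jm n\<close> and
  \<open>jm (Suc n)\<close>. The latter is \<open>jm n\<close> between two copies of the letter, so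
  the letter passes through their product because the two factors commute.\<close>

lemma Lam_S:
  "Suc n < N \<Longrightarrow> act (S (n + 3)) (acts (Lam N) A) = acts (Lam N) (act (S (n + 3)) A)"
proof (induction N arbitrary: A rule: less_induct)
  case (less N)
  then obtain N' where N: "N = Suc N'"
    by (cases N) auto
  show ?case
  proof (cases "N' = Suc n")
    case True
    have low: "act (S (n + 3)) (acts (Lam m) B) = acts (Lam m) (act (S (n + 3)) B)" if "m \<le> n" for m B
      using that by (induction m arbitrary: B) (simp_all add: jm_S_less)
    have "act (S (n + 3)) (acts (jm n) (acts (jm (Suc n)) A)) =
        acts (jm (Suc n)) (acts (jm n) (act (S (n + 3)) A))"
      by simp
    also have "\<dots> = acts (jm n) (acts (jm (Suc n)) (act (S (n + 3)) A))"
      by (rule jm_jm) simp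
    finally show ?thesis
      using low by (simp add: N True del: jm.simps)
  next
    case False
    then have "act (S (n + 3)) (acts (Lam N') B) = acts (Lam N') (act (S (n + 3)) B)"
      "act (S (n + 3)) (acts (jm N') B) = acts (jm N') (act (S (n + 3)) B)" for B
      using less.IH less.prems N by (auto intro!: jm_S_greater)
    then show ?thesis
      by (simp add: N)
  qed
qed

text \<open>The exponent \<open>e\<close> makes the index shift of \<open>Lam_T\<close> trivial, and
  the factors \<open>jm 0\<close> to \<open>jm (r - 2)\<close> reach exactly up to
  \<open>S r\<close>.\<close>

definition central :: "nat \<Rightarrow> cp_gen list" where
  "central r = concat (replicate e (Lam (r - 1)))"

fun proper :: "nat \<Rightarrow> cp_gen \<Rightarrow> bool" where
  "proper r (T i) \<longleftrightarrow> i < e"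
| "proper r (S k) \<longleftrightarrow> 3 \<le> k \<and> k \<le> r"

lemma central_commute:
  assumes "proper r x" "2 \<le> r"
  shows "acts (central r) (act x A) = act x (acts (central r) A)"
proof (cases x)
  case (T i)
  define N where "N = r - 1"
  have "acts (concat (replicate k (Lam N))) (act (T ((prd ^^ (k * Suc N)) i)) A) =
    act (T i) (acts (concat (replicate k (Lam N))) A)" if "i < e" for i k
    using that
  proof (induction k arbitrary: i)
    case (Suc k)
    have "(prd ^^ (Suc k * Suc N)) i = (prd ^^ (k * Suc N)) ((prd ^^ Suc N) i)"
      by (simp only: mult_Suc funpow_add o_apply add.commute [of "Suc N"])
    then show ?case
      using Suc Lam_T [of N i] assms by (simp add: N_def del: funpow.simps)
  qed simp
  from this [of i e] show ?thesis
    using assms T by (simp add: central_def N_def prd_pow_period del: mult_Suc_right)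
next
  case (S k)
  then obtain n where n: "k = n + 3"
    using assms by (auto simp: le_iff_add add.commute)
  have "act (S k) (acts (Lam (r - 1)) B) = acts (Lam (r - 1)) (act (S k) B)" for B
    unfolding n using assms S n by (intro Lam_S) auto
  then have "act (S k) (acts (concat (replicate m (Lam (r - 1)))) B) =
      acts (concat (replicate m (Lam (r - 1)))) (act (S k) B)" for m B
    by (induction m) simp_all
  then show ?thesis
    by (simp add: central_def S)
qed

lemma Lam_prefix: "m \<le> N \<Longrightarrow> \<exists>w. Lam N = Lam m @ w"
  by (induction N rule: dec_induct) auto

text \<open>The first factor \<open>Delta\<close> can be written with any \<open>T i\<close> in
  front. The factor \<open>jm (Suc n)\<close> starts with \<open>S (n + 3)\<close> and moves to the
  front because it commutes with the earlier ones.\<close>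

lemma central_divisible:
  assumes "proper r x" "2 \<le> r"
  shows "\<exists>w. \<forall>A. acts (central r) A = act x (acts w A)"
proof -
  have central: "central r = Lam (r - 1) @ concat (replicate (e - 1) (Lam (r - 1)))"
    using e_ge unfolding central_def by (cases e) auto
  have "\<exists>w. \<forall>A. acts (Lam (r - 1)) A = act x (acts w A)"
  proof (cases x)
    case (T i)
    have "1 \<le> r - 1"
      using assms by simp
    then obtain w where "Lam (r - 1) = Lam 1 @ w"
      using Lam_prefix by blast
    then have "acts (Lam (r - 1)) A = act x (acts (tp i # w) A)" for A
      using Delta_eq [of _ i] by (simp add: T)
    then show ?thesis
      by blast
  next
    case (S k)
    then obtain n where n: "k = n + 3"
      using assms by (auto simp: le_iff_add add.commute)
    have "Suc (Suc n) \<le> r - 1"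
      using assms S n by simp
    then obtain w where "Lam (r - 1) = Lam (Suc (Suc n)) @ w"
      using Lam_prefix by blast
    then have "acts (Lam (r - 1)) A = acts (jm (Suc n)) (acts (Lam (Suc n)) (acts w A))" for A
      by (simp add: Lam_jm [of "Suc n" "Suc (Suc n)"] del: jm.simps Lam_Suc add: Lam_Suc [of "Suc n"])
    then have "acts (Lam (r - 1)) A = act x (acts (jm n @ [S k] @ Lam (Suc n) @ w) A)" for A
      by (simp add: S n)
    then show ?thesis
      by blast
  qed
  then obtain w where "\<forall>A. acts (Lam (r - 1)) A = act x (acts w A)" ..
  then have "\<forall>A. acts (central r) A = act x (acts (w @ concat (replicate (e - 1) (Lam (r - 1)))) A)"
    by (simp add: central)
  then show ?thesis ..
qed

end

section \<open>Comparison with the braid group\<close>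

fun letter :: "bmr_gen \<Rightarrow> cp_gen" where
  "letter Tau2' = T 0"
| "letter (Tau k) = (if k = 2 then T 1 else S k)"

lemma inj_letter: "inj letter"
proof (rule injI)
  fix x y
  assume "letter x = letter y"
  then show "x = y"
    by (cases x; cases y) (auto split: if_splits)
qed

lemma map_alt_prod: "map f (alt_prod a b n) = alt_prod (f a) (f b) n"
  by (induction n arbitrary: a b) auto

context corran_picantin
begin

text \<open>Induction in steps of two: passing \<open>Delta\<close> lowers the index of
  \<open>T i\<close> by two, until at most one further letter remains.\<close>

lemma alt_prod_T:
  "(prd ^^ n) i = 1 \<Longrightarrow>
     act (T i) (acts (alt_prod (T 1) (T 0) n) A) = acts (alt_prod (T 1) (T 0) (Suc n)) A"
proof (induction n arbitrary: i A rule: induct_nat_012)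
  case 1
  then show ?case
    using Delta_eq [of A i] by simp
next
  case (ge2 n)
  have "(prd ^^ n) (prd (prd i)) = 1"
    using ge2.prems by (metis funpow_swap1 funpow.simps(2) o_apply)
  then have "act (tpp i) (acts (alt_prod (T 1) (T 0) n) A) = acts (alt_prod (T 1) (T 0) (Suc n)) A"
    by (rule ge2.IH(1))
  then show ?case
    using Delta_T [of i, symmetric] by simp
qed simp

lemma cls_alt_prod: "cls (alt_prod (T 1) (T 0) e) = cls (alt_prod (T 0) (T 1) e)"
proof -
  obtain m where m: "e = Suc m" "0 < m"
    using e_ge by (cases e) auto
  \<comment> \<open>Modulo \<open>Suc m\<close>, going down \<open>m\<close> times from 0 leads to
    1; \<open>prd_pow\<close> expresses the result as \<open>m * m\<close>.\<close>
  have "m * m = (m - 1) * Suc m + 1"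
    using m by (cases m) auto
  then have "m * m mod Suc m = 1"
    using m by (metis mod_mult_self3 mod_less Suc_less_eq One_nat_def)
  then have "(prd ^^ m) 0 = 1"
    using prd_pow [of 0 m] m by simp
  then have "act (T 0) (acts (alt_prod (T 1) (T 0) m) (cls [])) = acts (alt_prod (T 1) (T 0) (Suc m)) (cls [])"
    by (rule alt_prod_T)
  then have "cls (alt_prod (T 0) (T 1) (Suc m)) = cls (alt_prod (T 1) (T 0) (Suc m))"
    by (simp add: acts_cls act_cls)
  then show ?thesis
    by (simp only: flip: m(1))
qed

lemma com_cls: "com x y \<Longrightarrow> cls [x, y] = cls [y, x]"
  using com_act [of x y "cls []"] unfolding act_cls .

lemma brd_cls: "brd x y \<Longrightarrow> cls [x, y, x] = cls [y, x, y]"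
  using brd_act [of x y "cls []"] unfolding act_cls .

lemma letter_rel:
  assumes "(u, v) \<in> bmr_rels e r"
  shows "cls (map letter u) = cls (map letter v)"
proof -
  have com: "com (letter (Tau i)) (letter (Tau j))" if "2 \<le> \<bar>int i - int j\<bar>" "2 \<le> i" "2 \<le> j" for i j
  proof -
    have "i \<noteq> j" "i \<noteq> Suc j" "j \<noteq> Suc i" "i = 2 \<Longrightarrow> j \<noteq> 3" "j = 2 \<Longrightarrow> i \<noteq> 3"
      using that by arith+
    then show ?thesis
      by (simp add: com_T com_S)
  qed
  have brd: "brd (letter (Tau i)) (letter (Tau (i + 1)))" if "2 \<le> i" for i
  proof (cases "i = 2")
    case True
    then show ?thesis
      using brd_T(1) [of 1] by simp
  next
    case False
    then show ?thesis
      using that brd_S(1) [of i] by simp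
  qed
  \<comment> \<open>The six-letter relation says that \<open>jm 1\<close> and \<open>jm 0\<close>
    commute.\<close>
  have six: "cls [S 3, T 1, T 0, S 3, T 1, T 0] = cls [T 1, T 0, S 3, T 1, T 0, S 3]"
    using jm_jm [of 0 1 "cls []"] by (simp add: act_cls)
  consider
      (commuting) i j where "u = [Tau i, Tau j]" "v = [Tau j, Tau i]" "2 \<le> i" "2 \<le> j" "2 \<le> \<bar>int i - int j\<bar>"
    | (commuting') j where "u = [Tau2', Tau j]" "v = [Tau j, Tau2']" "4 \<le> j"
    | (alternating) "u = alt_prod (Tau 2) Tau2' e" "v = alt_prod Tau2' (Tau 2) e"
    | (braid) i where "u = [Tau i, Tau (i + 1), Tau i]" "v = [Tau (i + 1), Tau i, Tau (i + 1)]" "2 \<le> i"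
    | (braid') "u = [Tau2', Tau 3, Tau2']" "v = [Tau 3, Tau2', Tau 3]"
    | (six_letters) "u = [Tau 3, Tau 2, Tau2', Tau 3, Tau 2, Tau2']" "v = [Tau 2, Tau2', Tau 3, Tau 2, Tau2', Tau 3]"
    using assms unfolding bmr_rels_def by auto
  then show ?thesis
  proof cases
    case commuting
    then show ?thesis
      using com_cls com by simp
  next
    case commuting'
    then show ?thesis
      using com_cls [OF com_T(1), of j 0] by simp
  next
    case alternating
    then show ?thesis
      using cls_alt_prod by (simp add: map_alt_prod)
  next
    case braid
    then show ?thesis
      using brd_cls brd by simp
  next
    case braid'
    then show ?thesis
      using brd_cls [OF brd_T(1), of 0] by simp
  next
    case six_letters
    then show ?thesis
      using six by simp
  qed
qed

text \<open>Stands for the central element times the inverse of \<open>x\<close>. For proper letters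
  it exists by \<open>central_divisible\<close>, and cancellation makes its class unique.\<close>

definition bar :: "nat \<Rightarrow> cp_gen \<Rightarrow> cp_gen list" where
  "bar r x = (SOME w. cls (x # w) = cls (central r))"

lemma bar_right: "proper r x \<Longrightarrow> 2 \<le> r \<Longrightarrow> cls (x # bar r x) = cls (central r)"
proof -
  assume "proper r x" "2 \<le> r"
  then obtain w where "acts (central r) (cls []) = act x (acts w (cls []))"
    using central_divisible by blast
  then have "cls (x # w) = cls (central r)"
    by (simp add: acts_cls act_cls)
  then show ?thesis
    unfolding bar_def by (rule someI)
qed

text \<open>After multiplication by \<open>x\<close> on the left, centrality moves \<open>x\<close>
  to the front, where it cancels.\<close>

lemma bar_left:
  assumes "proper r x" "2 \<le> r"
  shows "cls (bar r x @ [x]) = cls (central r)"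
proof -
  have "act x (cls (bar r x @ [x])) = acts (x # bar r x) (cls [x])"
    by (simp add: acts_cls act_cls)
  also have "\<dots> = acts (central r) (act x (cls []))"
    using acts_cong [OF bar_right [OF assms]] by (simp add: act_cls)
  also have "\<dots> = act x (cls (central r))"
    by (simp add: central_commute [OF assms] acts_cls)
  finally show ?thesis
    by (rule cancel)
qed

lemma bar_commute:
  assumes "proper r x" "2 \<le> r"
  shows "acts (central r) (acts (bar r x) A) = acts (bar r x) (acts (central r) A)"
proof -
  have bar: "act x (acts (bar r x) B) = acts (central r) B" for B
    using acts_cong [OF bar_right [OF assms]] by simp
  have "act x (acts (central r) (acts (bar r x) B)) = act x (acts (bar r x) (acts (central r) B))" for B
    by (simp only: central_commute [OF assms, symmetric] bar)
  from this [of "cls []"] have "cls (central r @ bar r x) = cls (bar r x @ central r)"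
    using cancel [of x "central r @ bar r x" "bar r x @ central r"] by (simp only: acts_cls append_Nil2)
  from acts_cong [OF this] show ?thesis
    by simp
qed

fun signed :: "nat \<Rightarrow> bmr_gen \<times> bool \<Rightarrow> cp_gen list" where
  "signed r (x, True) = [letter x]"
| "signed r (x, False) = bar r (letter x)"

text \<open>A signed word \<open>w\<close> stands for the fraction of \<open>numerator r w\<close> by the \<open>negs w\<close>-th power of the
  central word.\<close>

definition numerator :: "nat \<Rightarrow> (bmr_gen \<times> bool) list \<Rightarrow> cp_gen list" where
  "numerator r w = concat (map (signed r) w)"

definition negs :: "('b \<times> bool) list \<Rightarrow> nat" where
  "negs w = length (filter (\<lambda>(x, b). \<not> b) w)"

definition cpow :: "nat \<Rightarrow> nat \<Rightarrow> cp_gen list" where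
  "cpow r k = concat (replicate k (central r))"

lemma numerator_simps [simp]:
  "numerator r [] = []" "numerator r (x # w) = signed r x @ numerator r w" "numerator r (u @ v) = numerator r u @ numerator r v"
  by (simp_all add: numerator_def)

lemma negs_append: "negs (u @ v) = negs u + negs v"
  by (simp add: negs_def)

lemma cpow_add: "cpow r (k + l) = cpow r k @ cpow r l"
  by (simp add: cpow_def replicate_add)

lemma cpow_commute: "acts (cpow r k) (acts (cpow r l) A) = acts (cpow r l) (acts (cpow r k) A)"
  by (metis cpow_add add.commute foldr_append o_apply)

lemma proper_letter: "x \<in> bmr_gens r \<Longrightarrow> proper r (letter x)"
  using e_ge by (auto simp: bmr_gens_def)

lemma numerator_commute:
  assumes "w \<in> lists (bmr_gens r \<times> UNIV)" "2 \<le> r"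
  shows "acts (cpow r k) (acts (numerator r w) A) = acts (numerator r w) (acts (cpow r k) A)"
proof -
  have "acts (central r) (acts (signed r (x, b)) A) = acts (signed r (x, b)) (acts (central r) A)"
    if "x \<in> bmr_gens r" for x b A
    using bar_commute [OF proper_letter [OF that] assms(2)]
      central_commute [OF proper_letter [OF that] assms(2)] by (cases b) simp_all
  then have "acts (central r) (acts (numerator r w) A) = acts (numerator r w) (acts (central r) A)" for A
    using assms(1) by (induction w) auto
  then show ?thesis
    by (induction k) (auto simp: cpow_def)
qed

lemma numerator_pos_word: "numerator r (pos_word w) = map letter w"
  by (induction w) (auto simp: pos_word_def)

lemma negs_pos_word: "negs (pos_word w) = 0"
  by (induction w) (auto simp: pos_word_def negs_def)

text \<open>Equality of fractions, expressed by cross-multiplication with the central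
  denominators.\<close>

lemma numerator_pcong:
  assumes "(u, v) \<in> pcong (bmr_gens r \<times> UNIV) (group_rels (bmr_gens r) (bmr_rels e r))" "2 \<le> r"
  shows "acts (cpow r (negs v)) (acts (numerator r u) A) = acts (cpow r (negs u)) (acts (numerator r v) A)"
  using assms(1)
proof (induction arbitrary: A rule: pcong.induct)
  case (base u v)
  from base(1) have "(\<exists>u' v'. u = pos_word u' \<and> v = pos_word v' \<and> (u', v') \<in> bmr_rels e r) \<or>
      (\<exists>x b. u = [(x, b), (x, \<not> b)] \<and> v = [] \<and> x \<in> bmr_gens r)"
    unfolding group_rels_def by simp
  then consider (pos) u' v' where "u = pos_word u'" "v = pos_word v'" "(u', v') \<in> bmr_rels e r"
    | (inv) x b where "u = [(x, b), (x, \<not> b)]" "v = []" "x \<in> bmr_gens r"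
    by (elim disjE exE conjE) simp_all
  then show ?case
  proof cases
    case pos
    then show ?thesis
      using acts_cong [OF letter_rel [OF pos(3)]]
      by (simp add: numerator_pos_word negs_pos_word cpow_def)
  next
    case inv
    have u: "cls (numerator r u) = cls (central r)"
      using bar_left [OF proper_letter [OF inv(3)] assms(2)]
        bar_right [OF proper_letter [OF inv(3)] assms(2)] by (cases b) (simp_all add: inv(1))
    moreover have "negs u = 1" "negs v = 0"
      using inv by (cases b; simp add: negs_def)+
    ultimately show ?thesis
      using acts_cong [OF u] inv(2) by (simp add: cpow_def)
  qed
next
  case (trans u v w)
  \<comment> \<open>Transitivity first holds up to the middle denominator. Cancellation is available
    for classes of words only, so the equation is specialised to the empty word, cancelled and
    extended to all sets again.\<close>
  have "acts (cpow r (negs v)) (acts (cpow r (negs w)) (acts (numerator r u) B)) =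
    acts (cpow r (negs v)) (acts (cpow r (negs u)) (acts (numerator r w) B))" for B
  proof -
    have "acts (cpow r (negs v)) (acts (cpow r (negs w)) (acts (numerator r u) B)) =
        acts (cpow r (negs w)) (acts (cpow r (negs u)) (acts (numerator r v) B))"
      by (simp only: cpow_commute [of r "negs v" "negs w"] trans.IH(1))
    also have "\<dots> = acts (cpow r (negs u)) (acts (cpow r (negs v)) (acts (numerator r w) B))"
      by (simp only: cpow_commute [of r "negs w" "negs u"] trans.IH(2))
    finally show ?thesis
      by (simp only: cpow_commute [of r "negs u" "negs v"])
  qed
  from this [of "cls []"] have "cls (cpow r (negs w) @ numerator r u) = cls (cpow r (negs u) @ numerator r w)"
    using cancel_acts [of "cpow r (negs v)" "cpow r (negs w) @ numerator r u" "cpow r (negs u) @ numerator r w"]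
    by (simp only: acts_cls append_Nil2)
  from acts_cong [OF this] show ?case
    by simp
next
  case (append u v u' v')
  then have "u \<in> lists (bmr_gens r \<times> UNIV)" "v \<in> lists (bmr_gens r \<times> UNIV)"
    using pcong_lists by blast+
  then show ?case
    using append.IH numerator_commute [OF _ assms(2)] by (simp add: negs_append cpow_add)
qed simp_all

theorem cls_eq_if_group_eq:
  assumes "(pos_word u, pos_word v) \<in> pcong (bmr_gens r \<times> UNIV) (group_rels (bmr_gens r) (bmr_rels e r))"
    "2 \<le> r"
  shows "cls (map letter u) = cls (map letter v)"
  using numerator_pcong [OF assms, of "cls []"] by (simp add: negs_pos_word numerator_pos_word cpow_def acts_cls)


section \<open>Words without alternatives\<close>

abbreviation taus :: "cp_gen set" where
  "taus \<equiv> {T 0, T 1} \<union> range S"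

text \<open>Only words in \<open>taus\<close>, which contains the images of the braid generators,
  compete: \<open>T 1\<close>, \<open>T 0\<close> also equals \<open>T 0\<close>,
  \<open>tp 0\<close>, but this uses a foreign letter.\<close>

definition rigid :: "cp_gen list \<Rightarrow> bool" where
  "rigid w \<longleftrightarrow> (\<forall>v. set v \<subseteq> taus \<longrightarrow> cls v = cls w \<longrightarrow> v = w)"

text \<open>A relation may change the index of a \<open>T i\<close>, but never the set of kinds that
  occur.\<close>

fun kind :: "cp_gen \<Rightarrow> nat option" where
  "kind (T i) = None"
| "kind (S k) = Some k"

lemma kind_compl: "insert (kind x) (kind ` set (compl x y)) = insert (kind y) (kind ` set (compl y x))"
  by (cases "(x, y)" rule: compl.cases) auto

lemma kind_cls:
  assumes "cls u = cls v"
  shows "kind ` set u = kind ` set v"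
proof -
  have step: "kind ` set u = kind ` set v" if "step u v" for u v
    using that
  proof cases
    case (1 p x y q)
    then show ?thesis
      using kind_compl [of x y] by (simp add: image_Un) blast
  qed
  have "step\<^sup>*\<^sup>* u v"
    using assms by (simp add: cls_eq_iff)
  then show ?thesis
    by (induction rule: rtranclp_induct) (simp_all add: step)
qed

lemma cls_ConsE:
  assumes "cls (x # u) = cls (y # v)"
  obtains w where "cls u = cls (compl x y @ w)" "cls v = cls (compl y x @ w)"
proof -
  have "act x (cls u) = act y (cls v)"
    using assms by (simp only: act_cls)
  then obtain w where "cls u = acts (compl x y) (cls w)" "cls v = acts (compl y x) (cls w)"
    by (rule lcm_letters)
  then show thesis
    unfolding acts_cls by (rule that)
qed

lemma cls_ConsD: "cls (x # u) = cls (x # v) \<Longrightarrow> cls u = cls v"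
  using cancel [of x u v] by (simp add: act_cls)

lemma rigid_Nil: "rigid []"
  unfolding rigid_def using cls_length [of _ "[]"] by simp

text \<open>Once the first letter is forced, left cancellation reduces to the rest of the
  word.\<close>

lemma rigid_Cons:
  assumes "rigid w" "\<And>y v. y \<in> taus \<Longrightarrow> set v \<subseteq> taus \<Longrightarrow> cls (y # v) = cls (x # w) \<Longrightarrow> y = x"
  shows "rigid (x # w)"
  unfolding rigid_def
proof (intro allI impI)
  fix v
  assume v: "set v \<subseteq> taus" "cls v = cls (x # w)"
  then obtain y v' where v': "v = y # v'"
    using cls_length [OF v(2)] by (cases v) auto
  then have "y = x"
    using assms(2) [of y v'] v by simp
  then show "v = x # w"
    using v v' cls_ConsD [of x v' w] assms(1) unfolding rigid_def by simp
qed

lemma rigid_factor: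
  assumes "rigid (p @ w @ q)" "set (p @ q) \<subseteq> taus"
  shows "rigid w"
  unfolding rigid_def
proof (intro allI impI)
  fix v
  assume v: "set v \<subseteq> taus" "cls v = cls w"
  have "cls (p @ v @ q) = cls (p @ w @ q)"
    using v(2) by (rule cls_append)
  moreover have "set (p @ v @ q) \<subseteq> taus"
    using v(1) assms(2) by simp
  ultimately have "p @ v @ q = p @ w @ q"
    using assms(1) unfolding rigid_def by blast
  then show "v = w"
    by simp
qed

section \<open>Possible first letters, and the two rigid families\<close>

lemma first_letter_power: "cls (y # w) = cls (replicate k x) \<Longrightarrow> y = x"
proof (induction k arbitrary: y w)
  case 0
  then show ?case
    using cls_length [of "y # w" "[]"] by simp
next
  case (Suc k)
  show ?case
  proof (rule ccontr)
    assume "y \<noteq> x"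
    have "cls (x # replicate k x) = cls (y # w)"
      using Suc.prems by simp
    then obtain w' where w': "cls (replicate k x) = cls (compl x y @ w')"
      by (rule cls_ConsE)
    moreover obtain z c where z: "compl x y = z # c"
      using \<open>y \<noteq> x\<close> by (cases "compl x y") auto
    moreover have "z \<noteq> x"
      using z \<open>y \<noteq> x\<close> by (cases "(x, y)" rule: compl.cases) (auto split: if_splits)
    ultimately show False
      using Suc.IH [of z "c @ w'"] by simp
  qed
qed

abbreviation pow1 :: "nat \<Rightarrow> cp_gen list" where
  "pow1 k \<equiv> replicate k (T 1)"

lemma rigid_pow1: "rigid (pow1 k)"
proof (induction k)
  case (Suc k)
  then show ?case
    using rigid_Cons first_letter_power [of _ _ "Suc k" "T 1"] by simp
qed (simp add: rigid_Nil)

lemma first_letter_s: "cls (T j # w) \<noteq> cls (S 3 # pow1 k)"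
proof
  assume "cls (T j # w) = cls (S 3 # pow1 k)"
  from this [symmetric] obtain w' where "cls (pow1 k) = cls (compl (S 3) (T j) @ w')"
    by (rule cls_ConsE)
  then have w': "cls (T j # S 3 # w') = cls (pow1 k)"
    by simp
  then have "j = 1"
    using first_letter_power by blast
  moreover obtain k' where "k = Suc k'"
    using cls_length [OF w'] by (cases k) auto
  ultimately have "cls (S 3 # w') = cls (pow1 k')"
    using w' cls_ConsD [of "T 1" "S 3 # w'" "pow1 k'"] by simp
  then show False
    using first_letter_power by blast
qed

lemma first_letter_bs:
  assumes "y \<in> {T 1, S 3}"
  shows "cls (y # w) \<noteq> cls (T 0 # S 3 # pow1 k)"
proof
  assume eq: "cls (y # w) = cls (T 0 # S 3 # pow1 k)"
  from eq [symmetric] obtain w' where w': "cls (S 3 # pow1 k) = cls (compl (T 0) y @ w')"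
    by (rule cls_ConsE)
  show False
  proof (cases "y = T 1")
    case True
    then show False
      using w' first_letter_s [THEN not_sym] by simp
  next
    case False
    then have "cls (S 3 # pow1 k) = cls (S 3 # T 0 # w')"
      using w' assms by simp
    then show False
      using first_letter_power [of "T 0" w' k "T 1"] cls_ConsD [of "S 3" "pow1 k" "T 0 # w'"] by simp
  qed
qed

text \<open>This word arises when \<open>T 1\<close>, \<open>T 0\<close> is rewritten as
  \<open>T 0\<close>, \<open>tp 0\<close> and \<open>T 0\<close> is cancelled. As \<open>e\<close>
  is at least 3, \<open>prd 0\<close> differs from 0 and 1.\<close>

lemma first_letter_cs:
  assumes "y \<in> {T 0, T 1, S 3}"
  shows "cls (y # w) \<noteq> cls (tp 0 # S 3 # pow1 k)"
proof
  assume eq: "cls (y # w) = cls (tp 0 # S 3 # pow1 k)"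
  have ne: "prd 0 \<noteq> 0" "prd 0 \<noteq> 1"
    using e_ge by (auto simp: prd_def)
  from eq [symmetric] obtain w' where w': "cls (S 3 # pow1 k) = cls (compl (tp 0) y @ w')"
    by (rule cls_ConsE)
  show False
  proof (cases "y = S 3")
    case True
    then have "cls (S 3 # pow1 k) = cls (S 3 # tp 0 # w')"
      using w' by simp
    then show False
      using first_letter_power [of "tp 0" w' k "T 1"] cls_ConsD [of "S 3" "pow1 k" "tp 0 # w'"] ne by simp
  next
    case False
    then show False
      using assms ne w' first_letter_s [THEN not_sym] by auto
  qed
qed

lemma cls_T1_T0: "cls (T 1 # T 0 # w) = cls (T 0 # tp 0 # w)"
  using Delta_eq [of "cls w" 0] by (simp add: act_cls)

lemma taus_kind:
  assumes "x \<in> taus" "kind x \<in> {None, Some 3}"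
  shows "x \<in> {T 0, T 1, S 3}"
  using assms by auto

text \<open>By \<open>kind_cls\<close> a competing word has no \<open>S k\<close> other than
  \<open>S 3\<close>, so just three first letters have to be tested.\<close>

lemma rigid_Cons3:
  assumes "rigid w" "set (x # w) \<subseteq> {T 0, T 1, S 3}"
    "\<And>y v. y \<in> {T 0, T 1, S 3} \<Longrightarrow> set v \<subseteq> {T 0, T 1, S 3} \<Longrightarrow> cls (y # v) = cls (x # w) \<Longrightarrow> y = x"
  shows "rigid (x # w)"
proof (rule rigid_Cons [OF assms(1)])
  fix y v
  assume *: "y \<in> taus" "set v \<subseteq> taus" "cls (y # v) = cls (x # w)"
  have "kind ` set (y # v) \<subseteq> {None, Some 3}"
    unfolding kind_cls [OF *(3)] using assms(2) by fastforce
  then have "z \<in> {T 0, T 1, S 3}" if "z \<in> set (y # v)" for z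
    using that * by (intro taus_kind) auto
  then show "y = x"
    using assms(3) * by (meson list.set_intros subsetI)
qed

lemma rigid_sabs_pow: "rigid (S 3 # T 1 # T 0 # S 3 # pow1 k)"
proof -
  have pow: "set (pow1 k) \<subseteq> {T 0, T 1, S 3}"
    by auto
  have 1: "rigid (S 3 # pow1 k)"
    using first_letter_s pow by (intro rigid_Cons3 rigid_pow1) auto
  have 2: "rigid (T 0 # S 3 # pow1 k)"
    using first_letter_bs pow by (intro rigid_Cons3 1) auto
  have 3: "rigid (T 1 # T 0 # S 3 # pow1 k)"
  proof (rule rigid_Cons3 [OF 2])
    fix y v
    assume y: "y \<in> {T 0, T 1, S 3}" "set v \<subseteq> {T 0, T 1, S 3}"
      and eq: "cls (y # v) = cls (T 1 # T 0 # S 3 # pow1 k)"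
    have "y \<noteq> T 0"
    proof
      assume "y = T 0"
      then have v: "cls v = cls (tp 0 # S 3 # pow1 k)"
        using eq cls_T1_T0 cls_ConsD [of "T 0" v] by simp
      then obtain z v' where "v = z # v'"
        using cls_length [OF v] by (cases v) auto
      then show False
        using first_letter_cs v y by auto
    qed
    moreover have "y \<noteq> S 3"
    proof
      assume "y = S 3"
      from eq [symmetric] obtain w where "cls (T 0 # S 3 # pow1 k) = cls (compl (T 1) y @ w)"
        by (rule cls_ConsE)
      then have "cls (T 0 # S 3 # pow1 k) = cls (S 3 # T 1 # w)"
        by (simp add: \<open>y = S 3\<close>)
      then show False
        using first_letter_bs [of "S 3" "T 1 # w" k] by simp
    qed
    ultimately show "y = T 1"
      using y by auto
  qed (use pow in auto)
  show ?thesis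
  proof (rule rigid_Cons3 [OF 3])
    fix y v
    assume y: "y \<in> {T 0, T 1, S 3}" and eq: "cls (y # v) = cls (S 3 # T 1 # T 0 # S 3 # pow1 k)"
    show "y = S 3"
    proof (rule ccontr)
      assume ne: "y \<noteq> S 3"
      from eq [symmetric] obtain w where "cls (T 1 # T 0 # S 3 # pow1 k) = cls (compl (S 3) y @ w)"
        by (rule cls_ConsE)
      moreover have "compl (S 3) y = [y, S 3]"
        using y ne by auto
      ultimately have w: "cls (T 1 # T 0 # S 3 # pow1 k) = cls (y # S 3 # w)"
        by simp
      show False
      proof (cases "y = T 1")
        case True
        then have "cls (T 0 # S 3 # pow1 k) = cls (S 3 # w)"
          using w cls_ConsD [of "T 1" "T 0 # S 3 # pow1 k" "S 3 # w"] by simp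
        then show False
          using first_letter_bs [of "S 3" w k] by simp
      next
        case False
        then have "cls (T 0 # tp 0 # S 3 # pow1 k) = cls (T 0 # S 3 # w)"
          using w y ne cls_T1_T0 by simp
        then show False
          using first_letter_cs [of "S 3" w k] cls_ConsD [of "T 0" "tp 0 # S 3 # pow1 k" "S 3 # w"] by simp
      qed
    qed
  qed (use pow in auto)
qed

lemma cls_pow1_T0: "cls (pow1 k @ [T 0]) = cls (T 0 # replicate k (tp 0))"
proof (induction k)
  case (Suc k)
  then show ?case
    using cls_Cons [OF Suc.IH, of "T 1"] cls_T1_T0 by simp
qed simp

text \<open>By \<open>cls_pow1_T0\<close>, a competitor beginning with \<open>T 0\<close> would
  continue with a power of \<open>tp 0\<close>. Such a power has no other first letter, and
  \<open>tp 0\<close> is not in \<open>taus\<close>.\<close>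

lemma rigid_pow1_T0: "rigid (pow1 k @ [T 0])"
proof (induction k)
  case 0
  have "y = T 0" if "cls (y # v) = cls [T 0]" for y v
    using first_letter_power [of y v 1 "T 0"] that by simp
  then show ?case
    using rigid_Cons [OF rigid_Nil] by simp
next
  case (Suc k)
  have "rigid (T 1 # (pow1 k @ [T 0]))"
  proof (rule rigid_Cons [OF Suc.IH])
    fix y v
    assume y: "y \<in> taus" "set v \<subseteq> taus" and eq: "cls (y # v) = cls (T 1 # (pow1 k @ [T 0]))"
    have "kind ` set (y # v) \<subseteq> {None}"
      unfolding kind_cls [OF eq] by auto
    then have "y \<in> {T 0, T 1}"
      using y by auto
    moreover have "y \<noteq> T 0"
    proof
      assume "y = T 0"
      then have v: "cls v = cls (replicate (Suc k) (tp 0))"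
        using eq cls_pow1_T0 [of "Suc k"] cls_ConsD [of "T 0" v "replicate (Suc k) (tp 0)"] by simp
      then obtain z v' where z: "v = z # v'"
        using cls_length [OF v] by (cases v) auto
      then have "z = tp 0"
        using v first_letter_power [of z v' "Suc k" "tp 0"] by simp
      then show False
        using y z e_ge by (auto simp: prd_def)
    qed
    ultimately show "y = T 1"
      by blast
  qed
  then show ?case
    by simp
qed


definition witness :: "nat \<Rightarrow> bmr_gen list" where
  "witness k = [Tau 3, Tau 2, Tau2', Tau 3] @ replicate k (Tau 2) @ [Tau2']"

text \<open>A factor avoiding the last letter lies in the word of \<open>rigid_sabs_pow\<close>. One
  that reaches the end has at most \<open>k\<close> of the \<open>k + 5\<close> letters, so it
  starts after the first four and lies in the word of \<open>rigid_pow1_T0\<close>.\<close>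

lemma rigid_witness_factor:
  assumes "witness k = p @ w @ q" "length w \<le> k"
  shows "rigid (map letter w)"
proof -
  have taus: "letter ` A \<subseteq> taus" for A
  proof
    fix x
    assume "x \<in> letter ` A"
    then obtain y where "x = letter y"
      by blast
    then show "x \<in> taus"
      by (cases y) auto
  qed
  have word: "map letter (witness k) = (S 3 # T 1 # T 0 # S 3 # pow1 k) @ [T 0]"
    by (simp add: witness_def)
  show ?thesis
  proof (cases q rule: rev_cases)
    case (snoc q' y)
    then have "map letter (p @ w @ q') = S 3 # T 1 # T 0 # S 3 # pow1 k"
      using word assms(1) by (metis append_assoc butlast_snoc map_append map_butlast)
    then have "rigid (map letter p @ map letter w @ map letter q')"
      using rigid_sabs_pow [of k] by simp
    then show ?thesis
      by (rule rigid_factor) (use taus [of "set p"] taus [of "set q'"] in auto)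
  next
    case Nil
    then have "p @ w = [Tau 3, Tau 2, Tau2', Tau 3] @ (replicate k (Tau 2) @ [Tau2'])"
      using assms(1) by (simp add: witness_def)
    moreover have "length [Tau 3, Tau 2, Tau2', Tau 3] \<le> length p"
      using arg_cong [OF calculation, of length] assms(2) by simp
    ultimately obtain p' where "p' @ w = replicate k (Tau 2) @ [Tau2']"
      by (metis append_eq_append_conv_if append_eq_conv_conj append_take_drop_id)
    then have "map letter (p' @ w) = map letter (replicate k (Tau 2) @ [Tau2'])"
      by (rule arg_cong)
    then have "map letter p' @ map letter w @ [] = pow1 k @ [T 0]"
      by simp
    then have "rigid (map letter p' @ map letter w @ [])"
      using rigid_pow1_T0 [of k] by simp
    then show ?thesis
      by (rule rigid_factor) (use taus [of "set p'"] in auto)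
  qed
qed

lemma rigid_letterD:
  assumes "rigid (map letter w)" "cls (map letter v) = cls (map letter w)"
  shows "v = w"
proof -
  have "letter y \<in> taus" for y
    by (cases y) auto
  then have "set (map letter v) \<subseteq> taus"
    by auto
  then have "map letter v = map letter w"
    using assms unfolding rigid_def by blast
  then show ?thesis
    using inj_letter by (simp add: inj_map_eq_map)
qed

lemma witness_isolated:
  assumes "\<And>u v. (u, v) \<in> P \<Longrightarrow> length u \<le> k \<and> length v \<le> k"
    and "\<And>u v. (u, v) \<in> P \<Longrightarrow> cls (map letter u) = cls (map letter v)"
    and "(witness k, v) \<in> pcong X P"
  shows "v = witness k"
proof -
  have rel: "p @ v @ q = witness k" if "(u, v) \<in> P \<or> (v, u) \<in> P" "p @ u @ q = witness k" for u v p q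
  proof -
    have "length u \<le> k" "cls (map letter v) = cls (map letter u)"
      using that(1) assms(1,2) by metis+
    moreover have "rigid (map letter u)"
      using rigid_witness_factor [OF that(2) [symmetric]] calculation(1) by blast
    ultimately have "v = u"
      using rigid_letterD by blast
    then show ?thesis
      using that(2) by simp
  qed
  \<comment> \<open>Arbitrary contexts let the induction pass the rule \<open>append\<close>; an
    equivalence handles \<open>sym\<close> and \<open>trans\<close>.\<close>
  have "p @ u @ q = witness k \<longleftrightarrow> p @ v @ q = witness k" if "(u, v) \<in> pcong X P" for u v p q
    using that
  proof (induction arbitrary: p q rule: pcong.induct)
    case (base u v)
    then show ?case
      using rel [of u v] rel [of v u] by blast
  next
    case (append u v u' v')
    have "p @ (u @ u') @ q = witness k \<longleftrightarrow> p @ v @ u' @ q = witness k"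
      using append.IH(1) [of p "u' @ q"] by simp
    also have "\<dots> \<longleftrightarrow> p @ (v @ v') @ q = witness k"
      using append.IH(2) [of "p @ v" q] by simp
    finally show ?case .
  qed simp_all
  from this [OF assms(3), of "[]" "[]"] show ?thesis
    by simp
qed

end

section \<open>The infinite family of relations\<close>

text \<open>Conjugation by \<open>x = s a b s\<close> carries \<open>b\<close> to \<open>a\<close>
  and \<open>a\<close> to \<open>a b a^-1\<close>. Hence it carries \<open>a^k b\<close> to
  \<open>(a b a^-1)^k a\<close>, which is \<open>a b^k\<close>.\<close>

lemma (in group) shifted_powers:
  fixes k :: nat
  assumes [simp]: "a \<in> carrier G" "b \<in> carrier G" "s \<in> carrier G"
    and as: "a \<otimes> (s \<otimes> a) = s \<otimes> (a \<otimes> s)" and bs: "b \<otimes> (s \<otimes> b) = s \<otimes> (b \<otimes> s)"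
    and six: "s \<otimes> (a \<otimes> (b \<otimes> (s \<otimes> (a \<otimes> b)))) = a \<otimes> (b \<otimes> (s \<otimes> (a \<otimes> (b \<otimes> s))))"
  shows "(s \<otimes> (a \<otimes> (b \<otimes> s))) \<otimes> (a [^] k \<otimes> b) = a \<otimes> (b [^] k \<otimes> (s \<otimes> (a \<otimes> (b \<otimes> s))))"
proof -
  define x where "x = s \<otimes> (a \<otimes> (b \<otimes> s))"
  have x [simp]: "x \<in> carrier G"
    by (simp add: x_def)
  have inv_a: "inv a \<otimes> (a \<otimes> y) = y" if "y \<in> carrier G" for y
    using that by (simp flip: m_assoc)
  have xb: "x \<otimes> b = a \<otimes> x"
  proof -
    have "x \<otimes> b = s \<otimes> (a \<otimes> (b \<otimes> (s \<otimes> b)))"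
      by (simp add: x_def m_assoc)
    also have "\<dots> = (s \<otimes> (a \<otimes> s)) \<otimes> (b \<otimes> s)"
      by (simp add: bs m_assoc)
    also have "\<dots> = a \<otimes> x"
      unfolding as [symmetric] by (simp add: x_def m_assoc)
    finally show ?thesis .
  qed
  have "x \<otimes> a \<otimes> b = (a \<otimes> b \<otimes> inv a \<otimes> x) \<otimes> b"
  proof -
    have "x \<otimes> a \<otimes> b = a \<otimes> (b \<otimes> x)"
      using six by (simp add: x_def m_assoc)
    also have "\<dots> = a \<otimes> (b \<otimes> (inv a \<otimes> (a \<otimes> x)))"
      by (simp flip: m_assoc)
    finally show ?thesis
      by (simp add: m_assoc flip: xb)
  qed
  then have xa: "x \<otimes> a = a \<otimes> b \<otimes> inv a \<otimes> x"
    by (rule right_cancel [THEN iffD1, rotated -1]) simp_all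
  have "x \<otimes> a [^] k = a \<otimes> (b [^] k \<otimes> (inv a \<otimes> x))"
  proof (induction k)
    case 0
    then show ?case
      by (simp flip: m_assoc)
  next
    case (Suc k)
    have "x \<otimes> a [^] Suc k = (x \<otimes> a [^] k) \<otimes> a"
      by (simp add: m_assoc)
    also have "\<dots> = a \<otimes> (b [^] k \<otimes> (inv a \<otimes> (x \<otimes> a)))"
      by (simp add: Suc m_assoc)
    also have "\<dots> = a \<otimes> (b [^] Suc k \<otimes> (inv a \<otimes> x))"
      unfolding xa by (simp add: inv_a m_assoc)
    finally show ?case .
  qed
  then have "x \<otimes> (a [^] k \<otimes> b) = a \<otimes> (b [^] k \<otimes> (inv a \<otimes> (x \<otimes> b)))"
    by (simp add: m_assoc [symmetric])
  then show ?thesis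
    unfolding xb by (simp add: inv_a flip: x_def)
qed

abbreviation pos_class :: "nat \<Rightarrow> nat \<Rightarrow> bmr_gen list \<Rightarrow> (bmr_gen \<times> bool) list set" where
  "pos_class e r w \<equiv> word_class (bmr_gens r \<times> UNIV) (group_rels (bmr_gens r) (bmr_rels e r)) (pos_word w)"

lemma pos_word_in_lists: "w \<in> lists X \<Longrightarrow> pos_word w \<in> lists (X \<times> UNIV)"
  by (auto simp: pos_word_def)

lemma pos_class_append:
  assumes "u \<in> lists (bmr_gens r)" "v \<in> lists (bmr_gens r)"
  shows "pos_class e r (u @ v) = pos_class e r u \<otimes>\<^bsub>bmr_braid_group e r\<^esub> pos_class e r v"
  using mult_pres_monoid [OF pos_word_in_lists [OF assms(1)] pos_word_in_lists [OF assms(2)]]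
  by (simp add: bmr_braid_group_def pres_group_def pos_word_def)

lemma pos_class_carrier:
  "w \<in> lists (bmr_gens r) \<Longrightarrow> pos_class e r w \<in> carrier (bmr_braid_group e r)"
  by (simp add: bmr_braid_group_def pres_group_def carrier_pres_monoid pos_word_in_lists)

lemma pos_class_eq_iff:
  assumes "u \<in> lists (bmr_gens r)" "v \<in> lists (bmr_gens r)"
  shows "pos_class e r u = pos_class e r v \<longleftrightarrow>
    (pos_word u, pos_word v) \<in> pcong (bmr_gens r \<times> UNIV) (group_rels (bmr_gens r) (bmr_rels e r))"
  by (intro word_class_eq_iff pos_word_in_lists assms)

lemma pos_class_rel:
  assumes "(u, v) \<in> bmr_rels e r" "u \<in> lists (bmr_gens r)" "v \<in> lists (bmr_gens r)"
  shows "pos_class e r u = pos_class e r v"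
  unfolding pos_class_eq_iff [OF assms(2,3)]
  using assms by (intro pcong.base pos_word_in_lists) (auto simp: group_rels_def)

lemma pos_class_replicate:
  assumes "x \<in> bmr_gens r"
  shows "pos_class e r (replicate k x) = pos_class e r [x] [^]\<^bsub>bmr_braid_group e r\<^esub> k"
proof -
  interpret group "bmr_braid_group e r"
    unfolding bmr_braid_group_def by (rule group_pres_group)
  have one: "pos_class e r [] = \<one>\<^bsub>bmr_braid_group e r\<^esub>"
    by (simp add: pos_word_def bmr_braid_group_def pres_group_def one_pres_monoid)
  show ?thesis
  proof (induction k)
    case (Suc k)
    then show ?case
      using pos_class_append [of "replicate k x" r "[x]" e] assms
      by (simp add: replicate_append_same in_lists_conv_set)
  qed (simp add: one)
qed

lemma witness_relation:
  assumes "3 \<le> r"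
  shows "pos_class e r ([Tau 3, Tau 2, Tau2', Tau 3] @ replicate k (Tau 2) @ [Tau2']) =
    pos_class e r ([Tau 2] @ replicate k Tau2' @ [Tau 3, Tau 2, Tau2', Tau 3])"
proof -
  let ?G = "bmr_braid_group e r"
  interpret group ?G
    unfolding bmr_braid_group_def by (rule group_pres_group)
  have gens [simp]: "Tau 2 \<in> bmr_gens r" "Tau2' \<in> bmr_gens r" "Tau 3 \<in> bmr_gens r"
    using assms by (auto simp: bmr_gens_def)
  have replicate [simp]: "x \<in> bmr_gens r \<Longrightarrow> replicate k x \<in> lists (bmr_gens r)" for x k
    by (auto simp: in_lists_conv_set)
  note [simp] = pos_class_carrier pos_class_replicate
  \<comment> \<open>Nonempty tails only, so that rewriting stops at one-letter words.\<close>
  have Cons: "pos_class e r (x # y # w) = pos_class e r [x] \<otimes>\<^bsub>?G\<^esub> pos_class e r (y # w)"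
    if "x \<in> bmr_gens r" "y # w \<in> lists (bmr_gens r)" for x y w
    using pos_class_append [of "[x]" r "y # w" e] that by simp
  have rels: "([Tau 2, Tau 3, Tau 2], [Tau 3, Tau 2, Tau 3]) \<in> bmr_rels e r"
    "([Tau2', Tau 3, Tau2'], [Tau 3, Tau2', Tau 3]) \<in> bmr_rels e r"
    "([Tau 3, Tau 2, Tau2', Tau 3, Tau 2, Tau2'],
       [Tau 2, Tau2', Tau 3, Tau 2, Tau2', Tau 3]) \<in> bmr_rels e r"
    using assms unfolding bmr_rels_def by force+
  have lists: "[Tau 3, Tau 2, Tau2', Tau 3] \<in> lists (bmr_gens r)" "[Tau 2] \<in> lists (bmr_gens r)"
    "[Tau2'] \<in> lists (bmr_gens r)"
    by simp_all
  show ?thesis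
    unfolding pos_class_append [OF lists(1) append_in_lists_conv [THEN iffD2, OF conjI, OF replicate [OF gens(1)] lists(3)]]
      pos_class_append [OF replicate [OF gens(1)] lists(3)]
      pos_class_append [OF lists(2) append_in_lists_conv [THEN iffD2, OF conjI, OF replicate [OF gens(2)] lists(1)]]
      pos_class_append [OF replicate [OF gens(2)] lists(1)]
    using shifted_powers [of "pos_class e r [Tau 2]" "pos_class e r [Tau2']" "pos_class e r [Tau 3]" k]
      rels [THEN pos_class_rel]
    by (simp add: Cons)
qed

theorem proposition22:
  fixes e r :: nat
  assumes "e \<ge> 3" and "r \<ge> 3"
  shows "\<nexists>P. finite P \<and> P \<subseteq> lists (bmr_gens r) \<times> lists (bmr_gens r) \<and>
    presents_via_identity (bmr_gens r) P (bmr_elem e r) (bmr_braid_group e r) \<and>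
    monoid_embeds (bmr_gens r) P (bmr_elem e r) (bmr_braid_group e r)"
proof
  assume "\<exists>P. finite P \<and> P \<subseteq> lists (bmr_gens r) \<times> lists (bmr_gens r) \<and>
    presents_via_identity (bmr_gens r) P (bmr_elem e r) (bmr_braid_group e r) \<and>
    monoid_embeds (bmr_gens r) P (bmr_elem e r) (bmr_braid_group e r)"
  then obtain P where fin: "finite P" and sub: "P \<subseteq> lists (bmr_gens r) \<times> lists (bmr_gens r)"
    and emb: "monoid_embeds (bmr_gens r) P (bmr_elem e r) (bmr_braid_group e r)"
    by blast
  interpret corran_picantin e
    by standard (rule assms(1))
  let ?X = "bmr_gens r" and ?G = "bmr_braid_group e r"
  interpret G: group ?G
    unfolding bmr_braid_group_def by (rule group_pres_group)
  obtain \<psi> where \<psi>: "\<psi> \<in> mon (pres_monoid ?X P) ?G" "\<And>x. x \<in> ?X \<Longrightarrow> \<psi> (monoid_gen ?X P x) = bmr_elem e r x"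
    using emb unfolding monoid_embeds_def by blast
  have hom: "\<psi> (word_class ?X P (u @ v)) = \<psi> (word_class ?X P u) \<otimes>\<^bsub>?G\<^esub> \<psi> (word_class ?X P v)"
    and car: "\<psi> (word_class ?X P u) \<in> carrier ?G"
    if "u \<in> lists ?X" "v \<in> lists ?X" for u v
    using \<psi>(1) that unfolding mon_def hom_def
    by (auto simp: carrier_pres_monoid simp flip: mult_pres_monoid)
  have \<psi>_word: "\<psi> (word_class ?X P w) = pos_class e r w" if "w \<in> lists ?X" for w
    using that
  proof (induction w)
    case Nil
    \<comment> \<open>The image of the empty word is idempotent, hence the unit of the
      group.\<close>
    have "\<psi> (word_class ?X P []) = \<one>\<^bsub>?G\<^esub>"
      using hom [of "[]" "[]"] car [of "[]" "[]"] by simp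
    then show ?case
      by (simp add: pos_word_def bmr_braid_group_def pres_group_def one_pres_monoid)
  next
    case (Cons x w)
    then have "\<psi> (word_class ?X P [x]) = pos_class e r [x]"
      using \<psi>(2) by (simp add: monoid_gen_def bmr_elem_def group_gen_def pos_word_def)
    then show ?case
      using Cons hom [of "[x]" w] pos_class_append [of "[x]" r w e] by simp
  qed
  \<comment> \<open>Through \<open>\<psi>\<close> the relations of \<open>P\<close> hold in the
    braid group, hence in the Corran-Picantin monoid.\<close>
  have P_cls: "cls (map letter u) = cls (map letter v)" if "(u, v) \<in> P" for u v
  proof -
    have uv: "u \<in> lists ?X" "v \<in> lists ?X"
      using that sub by auto
    then have "word_class ?X P u = word_class ?X P v"
      using that by (simp add: word_class_eq_iff pcong.base del: in_lists_conv_set)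
    then have "pos_class e r u = pos_class e r v"
      using \<psi>_word uv by metis
    then show ?thesis
      using pos_class_eq_iff [OF uv] assms cls_eq_if_group_eq by auto
  qed
  \<comment> \<open>The greatest length of a side of a relation; 0 is inserted to cover an empty
    \<open>P\<close>.\<close>
  define k where "k = Max (insert 0 (length ` (fst ` P \<union> snd ` P)))"
  have len: "length u \<le> k \<and> length v \<le> k" if "(u, v) \<in> P" for u v
  proof -
    have "length u \<in> length ` (fst ` P \<union> snd ` P)" "length v \<in> length ` (fst ` P \<union> snd ` P)"
      using that by force+
    then show ?thesis
      unfolding k_def using fin by (intro conjI Max_ge) auto
  qed
  let ?v = "[Tau 2] @ replicate k Tau2' @ [Tau 3, Tau 2, Tau2', Tau 3]"
  have words: "witness k \<in> lists ?X" "?v \<in> lists ?X"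
    using assms by (auto simp: witness_def bmr_gens_def)
  have eq: "\<psi> (word_class ?X P (witness k)) = \<psi> (word_class ?X P ?v)"
    unfolding \<psi>_word [OF words(1)] \<psi>_word [OF words(2)] unfolding witness_def
    by (rule witness_relation) (rule assms(2))
  have inj: "inj_on \<psi> (word_class ?X P ` lists ?X)"
    using \<psi>(1) by (simp add: mon_def carrier_pres_monoid)
  have "word_class ?X P (witness k) = word_class ?X P ?v"
    by (rule inj_onD [OF inj eq imageI [OF words(1)] imageI [OF words(2)]])
  then have "(witness k, ?v) \<in> pcong ?X P"
    by (rule word_class_eq_iff [OF words, THEN iffD1])
  with len P_cls have "?v = witness k"
    by (rule witness_isolated)
  \<comment> \<open>The two words begin with different letters.\<close>
  then show False
    by (simp add: witness_def)
qed

end
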